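(* Let $\mathbb{G}$ be a homogeneous group of topological dimension $\mathrm q$ and let $d$ be a multiradial distance on $\mathbb{G}$. Then for every $1\le n\le\mathrm q-1$ and every $n$-dimensional homogeneous subspace $V\subset\mathbb{G}$, $$\beta_d(V)=\mathcal{H}^n_{|\cdot|}(V\cap\mathbb{B}(0,1)).$$
   Context: **Homogeneous groups.** A graded group of step $\iota$ is a connected, simply connected, nilpotent Lie group whose Lie algebra is a direct sum $H_1\oplus\cdots\oplus H_\iota$ with $[H_i,H_j]\subset H_{i+j}$ ($H_k=\{0\}$ for $k>\iota$) and $H_\iota\neq\{0\}$. Through the exponential map it is identified with its Lie algebra, so $\mathbb{G}=H_1\oplus\cdots\oplus H_\iota$ is a finite-dimensional real vector space with the group product given by the Baker–Campbell–Hausdorff formula; the unit is $0$. $P_{H_j}:\mathbb{G}\to H_j$ are the linear projections. Dilations $\delta_r$, $r>0$, are the linear maps acting as multiplication by $r^i$ on $H_i$; with them $\mathbb{G}$ is a homogeneous group. A homogeneous distance $d$ is a distance with $d(zx,zy)=d(x,y)$ and $d(\delta_rx,\delta_ry)=r\,d(x,y)$ for all $x,y,z\in\mathbb{G}$, $r>0$. $\mathbb{B}(x,r)=\{y: d(x,y)\le r\}$. A scalar product on $\mathbb{G}$ making the layers $H_i$ mutually orthogonal is fixed, with norm $|\cdot|$; $\mathcal{H}^n_{|\cdot|}$ is the $n$-dimensional Euclidean Hausdorff measure (normalized to agree with Lebesgue measure on $n$-planes). A homogeneous subspace is a linear subspace invariant under all $\delta_r$. **Multiradial distance.** A homogeneous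 distance $d$ is multiradial if there is a continuous $\varphi:[0,+\infty)^\iota\to[0,+\infty)$, nondecreasing in each variable, with $\varphi(0)=0$, $\varphi(t)\to+\infty$ as $|t|\to+\infty$, and $\mathbb{B}(0,1)=\{x\in\mathbb{G}:\varphi(|P_{H_1}(x)|,\dots,|P_{H_\iota}(x)|)\le1\}$. **Spherical factor.** For a linear subspace $V\subset\mathbb{G}$ of dimension $n$, $\beta_d(V)=\max_{z\in\mathbb{B}(0,1)}\mathcal{H}^n_{|\cdot|}(V\cap\mathbb{B}(z,1))$. *)

theory Defs
  imports "HOL-Analysis.Analysis"
begin

text \<open>
  A graded group is identified with its Lie algebra through the exponential map. The Lie algebra
  lives on a type of class \<open>euclidean_space\<close>, whose inner product is the fixed scalar product and
  whose norm is the Euclidean norm of the group. \<open>br\<close> is the Lie bracket and \<open>H i\<close>, for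
  \<open>1 \<le> i \<le> \<iota>\<close>, are the layers; \<open>H 0\<close> is irrelevant. A Lie algebra graded in this way is
  automatically nilpotent.
\<close>

locale graded_group =
  fixes br :: "'a::euclidean_space \<Rightarrow> 'a \<Rightarrow> 'a"
    and H :: "nat \<Rightarrow> 'a set"
    and \<iota> :: nat
  assumes bilinear_br: "bilinear br"
    and br_self: "br x x = 0"
    and jacobi: "br x (br y z) + br y (br z x) + br z (br x y) = 0"
    and step_pos: "1 \<le> \<iota>"
    and layer_subspace: "1 \<le> i \<Longrightarrow> i \<le> \<iota> \<Longrightarrow> subspace (H i)"
    and direct_sum: "\<exists>!c. c \<in> (\<Pi>\<^sub>E i\<in>{1..\<iota>}. H i) \<and> x = (\<Sum>i\<in>{1..\<iota>}. c i)"
    and layer_trivial: "\<iota> < k \<Longrightarrow> H k = {0}"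
    and layer_top: "H \<iota> \<noteq> {0}"
    and br_layer: "1 \<le> i \<Longrightarrow> 1 \<le> j \<Longrightarrow> x \<in> H i \<Longrightarrow> y \<in> H j \<Longrightarrow> br x y \<in> H (i + j)"

definition orthogonal_layers :: "(nat \<Rightarrow> 'a::euclidean_space set) \<Rightarrow> nat \<Rightarrow> bool" where
  "orthogonal_layers H \<iota> \<longleftrightarrow>
     (\<forall>i\<in>{1..\<iota>}. \<forall>j\<in>{1..\<iota>}. i \<noteq> j \<longrightarrow> (\<forall>x\<in>H i. \<forall>y\<in>H j. orthogonal x y))"

definition layer_proj :: "(nat \<Rightarrow> 'a::euclidean_space set) \<Rightarrow> nat \<Rightarrow> nat \<Rightarrow> 'a \<Rightarrow> 'a" where
  "layer_proj H \<iota> j x = (THE c. c \<in> (\<Pi>\<^sub>E i\<in>{1..\<iota>}. H i) \<and> x = (\<Sum>i\<in>{1..\<iota>}. c i)) j"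

definition dilation :: "(nat \<Rightarrow> 'a::euclidean_space set) \<Rightarrow> nat \<Rightarrow> real \<Rightarrow> 'a \<Rightarrow> 'a" where
  "dilation H \<iota> r x = (\<Sum>i\<in>{1..\<iota>}. r ^ i *\<^sub>R layer_proj H \<iota> i x)"

text \<open>
  The group product is the Baker--Campbell--Hausdorff series in Dynkin's form. Its terms are indexed
  by nonempty lists \<open>(r\<^sub>1,s\<^sub>1),\<dots>,(r\<^sub>k,s\<^sub>k)\<close> with \<open>r\<^sub>i + s\<^sub>i > 0\<close>; such a list stands for the
  right-nested bracket \<open>[x,[x,\<dots>,[y,[y,\<dots>]]]]\<close> of the word \<open>x\<^sup>r\<^sup>1 y\<^sup>s\<^sup>1 \<dots> x\<^sup>r\<^sup>k y\<^sup>s\<^sup>k\<close>, with coefficient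
  \<open>(-1)^(k-1) / (k (\<Sum>i. r\<^sub>i + s\<^sub>i) (\<Prod>i. r\<^sub>i! s\<^sub>i!))\<close>. Brackets of more than \<open>\<iota>\<close> letters vanish in
  step \<open>\<iota>\<close>, so only words of length at most \<open>\<iota>\<close> occur and the sum is finite.
\<close>

fun nested_bracket :: "('a::euclidean_space \<Rightarrow> 'a \<Rightarrow> 'a) \<Rightarrow> 'a list \<Rightarrow> 'a" where
  "nested_bracket br [] = 0"
| "nested_bracket br [a] = a"
| "nested_bracket br (a # b # w) = br a (nested_bracket br (b # w))"

definition dynkin_word :: "'a \<Rightarrow> 'a \<Rightarrow> (nat \<times> nat) list \<Rightarrow> 'a list" where
  "dynkin_word x y ps = concat (map (\<lambda>(r, s). replicate r x @ replicate s y) ps)"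

definition dynkin_degree :: "(nat \<times> nat) list \<Rightarrow> nat" where
  "dynkin_degree ps = (\<Sum>(r, s)\<leftarrow>ps. r + s)"

definition dynkin_coeff :: "(nat \<times> nat) list \<Rightarrow> real" where
  "dynkin_coeff ps =
     (- 1) ^ (length ps - 1) /
     (real (length ps) * real (dynkin_degree ps) * (\<Prod>(r, s)\<leftarrow>ps. fact r * fact s))"

definition bch :: "('a::euclidean_space \<Rightarrow> 'a \<Rightarrow> 'a) \<Rightarrow> nat \<Rightarrow> 'a \<Rightarrow> 'a \<Rightarrow> 'a" where
  "bch br \<iota> x y =
     (\<Sum>ps | ps \<noteq> [] \<and> (\<forall>(r, s)\<in>set ps. 0 < r + s) \<and> dynkin_degree ps \<le> \<iota>.
        dynkin_coeff ps *\<^sub>R nested_bracket br (dynkin_word x y ps))"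

definition homogeneous_distance ::
  "('a::euclidean_space \<Rightarrow> 'a \<Rightarrow> 'a) \<Rightarrow> (nat \<Rightarrow> 'a set) \<Rightarrow> nat \<Rightarrow> ('a \<Rightarrow> 'a \<Rightarrow> real) \<Rightarrow> bool" where
  "homogeneous_distance br H \<iota> d \<longleftrightarrow>
     Metric_space UNIV d \<and>
     (\<forall>x y z. d (bch br \<iota> z x) (bch br \<iota> z y) = d x y) \<and>
     (\<forall>x y r. 0 < r \<longrightarrow> d (dilation H \<iota> r x) (dilation H \<iota> r y) = r * d x y)"

abbreviation dball :: "('a \<Rightarrow> 'a \<Rightarrow> real) \<Rightarrow> 'a \<Rightarrow> real \<Rightarrow> 'a set" where
  "dball d \<equiv> Metric_space.mcball UNIV d"

text \<open>
  The orthant \<open>[0,\<infinity>)\<^sup>\<iota>\<close> consists of the extensional functions on \<open>{1..\<iota>}\<close> with nonnegative values,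
  in the product topology of \<open>nat \<Rightarrow> real\<close>; its subspace topology is the Euclidean one.
\<close>

definition orthant :: "nat \<Rightarrow> (nat \<Rightarrow> real) set" where
  "orthant \<iota> = (\<Pi>\<^sub>E i\<in>{1..\<iota>}. {0..})"

definition multiradial ::
  "('a::euclidean_space \<Rightarrow> 'a \<Rightarrow> 'a) \<Rightarrow> (nat \<Rightarrow> 'a set) \<Rightarrow> nat \<Rightarrow> ('a \<Rightarrow> 'a \<Rightarrow> real) \<Rightarrow> bool" where
  "multiradial br H \<iota> d \<longleftrightarrow>
     homogeneous_distance br H \<iota> d \<and>
     (\<exists>\<phi> :: (nat \<Rightarrow> real) \<Rightarrow> real. \<phi> \<in> orthant \<iota> \<rightarrow> {0..} \<and>
          continuous_on (orthant \<iota>) \<phi> \<and>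
          (\<forall>t\<in>orthant \<iota>. \<forall>i\<in>{1..\<iota>}. \<forall>s\<ge>t i. \<phi> t \<le> \<phi> (t(i := s))) \<and>
          \<phi> (\<lambda>i\<in>{1..\<iota>}. 0) = 0 \<and>
          filterlim \<phi> at_top
            (inf (filtercomap (\<lambda>t. L2_set t {1..\<iota>}) at_top) (principal (orthant \<iota>))) \<and>
          dball d 0 1 = {x. \<phi> (\<lambda>j\<in>{1..\<iota>}. norm (layer_proj H \<iota> j x)) \<le> 1})"

definition homogeneous_subspace ::
  "(nat \<Rightarrow> 'a::euclidean_space set) \<Rightarrow> nat \<Rightarrow> 'a set \<Rightarrow> bool" where
  "homogeneous_subspace H \<iota> V \<longleftrightarrow> subspace V \<and> (\<forall>r>0. dilation H \<iota> r ` V \<subseteq> V)"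

text \<open>
  Euclidean Hausdorff (outer) measure. The factor \<open>unit_ball_vol n / 2^n\<close> normalizes it to agree with
  Lebesgue measure on \<open>n\<close>-planes. Empty covering sets contribute \<open>0\<close> also for \<open>n = 0\<close>, and
  boundedness is required because \<open>diameter\<close> is meaningless on unbounded sets.
\<close>

definition hausdorff_pre :: "nat \<Rightarrow> real \<Rightarrow> 'a::euclidean_space set \<Rightarrow> ennreal" where
  "hausdorff_pre n \<delta> A =
     (INF E \<in> {E :: nat \<Rightarrow> 'a set. A \<subseteq> (\<Union>i. E i) \<and> (\<forall>i. bounded (E i) \<and> diameter (E i) \<le> \<delta>)}.
        \<Sum>i. if E i = {} then 0 else ennreal (unit_ball_vol n * (diameter (E i) / 2) ^ n))"

definition hausdorff_measure :: "nat \<Rightarrow> 'a::euclidean_space set \<Rightarrow> ennreal" where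
  "hausdorff_measure n A = (SUP \<delta> \<in> {0<..}. hausdorff_pre n \<delta> A)"

text \<open>
  The maximum over the unit ball is written as a supremum in \<open>ennreal\<close>, which always exists and
  coincides with the maximum whenever the latter is attained. An equality of the spherical factor with
  the value at a point of the ball (such as \<open>z = 0\<close>) therefore says that the maximum is attained there.
\<close>

definition spherical_factor ::
  "('a::euclidean_space \<Rightarrow> 'a \<Rightarrow> real) \<Rightarrow> 'a set \<Rightarrow> ennreal" where
  "spherical_factor d V = (SUP z \<in> dball d 0 1. hausdorff_measure (dim V) (V \<inter> dball d z 1))"

end

theory Submission
  imports Defs
begin

text \<open>
  Left translation by \<open>z\<^sup>-\<^sup>1\<close> changes the \<open>j\<close>-th layer component of \<open>v\<close> by adding a term that
  depends only on the components of \<open>v\<close> in lower layers. In orthonormal coordinates of \<open>V\<close> adapted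
  to the layers, \<open>v \<mapsto> z\<^sup>-\<^sup>1 v\<close> followed by the orthogonal projection to \<open>V\<close> is therefore a
  triangular shear, which preserves Lebesgue measure by Fubini's theorem. The projection commutes with
  the layer projections and so decreases all layer norms; as the distance is multiradial, the shear
  maps \<open>V \<inter> B(z, 1)\<close> into \<open>V \<inter> B(0, 1)\<close>. On bounded Borel subsets of \<open>V\<close> the Hausdorff
  measure is a constant multiple of Lebesgue measure; the value of the constant is irrelevant.
\<close>

section \<open>Hausdorff measure as an outer measure\<close>

text \<open>\<open>V\<close> need not be a subgroup, so left translation may carry it to a curved
  set, and invariance of the distance alone compares nothing inside \<open>V\<close>. Projecting
  back to \<open>V\<close> keeps both balls in one fixed plane. Two facts make this work. Every term
  of the Baker-Campbell-Hausdorff series beyond x + y contains a bracket, and bracketing with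
  anything raises the degree by at least one; hence the dependence on strictly lower layers.
  Homogeneity splits \<open>V\<close> into its intersections with the layers, since pairing the
  dilates of a vector of \<open>V\<close> with a fixed vector gives a polynomial in the dilation
  factor; hence the projection to \<open>V\<close> respects the layers. On the measure side, covers
  directly give only subadditivity and upper bounds. These bounds pass from dyadic cubes to open and
  then to Borel sets, and they become an equality because a box has the same density as the unit
  cube.\<close>

definition diam_gauge :: "nat \<Rightarrow> 'a::euclidean_space set \<Rightarrow> ennreal" where
  "diam_gauge n E = (if E = {} then 0 else ennreal (unit_ball_vol n * (diameter E / 2) ^ n))"

lemma diam_gauge_empty [simp]: "diam_gauge n {} = 0"
  by (simp add: diam_gauge_def)

lemma hausdorff_pre_gauge:
  "hausdorff_pre n \<delta> A =
    (INF E \<in> {E :: nat \<Rightarrow> 'a::euclidean_space set. A \<subseteq> (\<Union>i. E i) \<and> (\<forall>i. bounded (E i) \<and> diameter (E i) \<le> \<delta>)}.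
       \<Sum>i. diam_gauge n (E i))"
  by (simp add: hausdorff_pre_def diam_gauge_def)

lemma hausdorff_pre_le:
  assumes "A \<subseteq> (\<Union>i. E i)" "\<And>i. bounded (E i)" "\<And>i. diameter (E i) \<le> \<delta>"
  shows "hausdorff_pre n \<delta> A \<le> (\<Sum>i. diam_gauge n (E i))"
  unfolding hausdorff_pre_gauge by (rule INF_lower) (use assms in auto)

lemma hausdorff_pre_mono: "A \<subseteq> B \<Longrightarrow> hausdorff_pre n \<delta> A \<le> hausdorff_pre n \<delta> B"
  unfolding hausdorff_pre_gauge by (rule INF_superset_mono) auto

lemma hausdorff_pre_single:
  assumes "bounded A" "diameter A \<le> \<delta>" "0 \<le> \<delta>"
  shows "hausdorff_pre n \<delta> A \<le> diam_gauge n A"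
proof -
  let ?E = "\<lambda>i::nat. if i = 0 then A else {}"
  have "hausdorff_pre n \<delta> A \<le> (\<Sum>i. diam_gauge n (?E i))"
    by (rule hausdorff_pre_le) (use assms in auto)
  also have "\<dots> = (\<Sum>i\<in>{0::nat}. diam_gauge n (?E i))"
    by (rule suminf_finite) auto
  finally show ?thesis by simp
qed

lemma hausdorff_pre_empty: "0 \<le> \<delta> \<Longrightarrow> hausdorff_pre n \<delta> {} = 0"
  using hausdorff_pre_single[of "{}" \<delta> n] by simp

text \<open>Covers of the \<open>A i\<close> with excess at most \<epsilon>/2^(i+1) are merged into
  one sequence by the pairing \<open>prod_decode\<close>, and the excesses add up to
  \<epsilon>.\<close>

lemma hausdorff_pre_UN:
  "hausdorff_pre n \<delta> (\<Union>i::nat. A i) \<le> (\<Sum>i. hausdorff_pre n \<delta> (A i))"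
proof (rule ennreal_le_epsilon)
  fix \<epsilon> :: real assume fin: "(\<Sum>i. hausdorff_pre n \<delta> (A i)) < top" and "0 < \<epsilon>"
  \<comment> \<open>Adding a positive number to the infimum is strict only below infinity, and
    strictness is what yields a nearly optimal cover.\<close>
  have "hausdorff_pre n \<delta> (A i) \<noteq> \<infinity>" for i
    using fin ennreal_suminf_lessD[of "\<lambda>i. hausdorff_pre n \<delta> (A i)" top i] by auto
  then have "\<exists>E. A i \<subseteq> (\<Union>j. E j) \<and> (\<forall>j. bounded (E j) \<and> diameter (E j) \<le> \<delta>) \<and>
      (\<Sum>j. diam_gauge n (E j)) \<le> hausdorff_pre n \<delta> (A i) + ennreal (\<epsilon> * (1/2) ^ Suc i)" for i
  proof -
    have "hausdorff_pre n \<delta> (A i) < hausdorff_pre n \<delta> (A i) + ennreal (\<epsilon> * (1/2) ^ Suc i)"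
      using \<open>hausdorff_pre n \<delta> (A i) \<noteq> \<infinity>\<close> \<open>0 < \<epsilon>\<close>
      by (auto simp: less_top[symmetric] intro!: ennreal_add_left_cancel_less[THEN iffD2, of _ 0, simplified])
    then show ?thesis
      unfolding hausdorff_pre_gauge[of n \<delta> "A i"] INF_less_iff by (auto intro: less_imp_le)
  qed
  then obtain E where E: "\<And>i. A i \<subseteq> (\<Union>j. E i j)" "\<And>i j. bounded (E i j)" "\<And>i j. diameter (E i j) \<le> \<delta>"
    and le: "\<And>i. (\<Sum>j. diam_gauge n (E i j)) \<le> hausdorff_pre n \<delta> (A i) + ennreal (\<epsilon> * (1/2) ^ Suc i)"
    by metis
  define F where "F m = case_prod E (prod_decode m)" for m
  have "(\<Union>i. A i) \<subseteq> (\<Union>m. F m)"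
  proof
    fix x assume "x \<in> (\<Union>i. A i)"
    then obtain i j where "x \<in> E i j" using E(1) by blast
    then have "x \<in> F (prod_encode (i, j))" by (simp add: F_def)
    then show "x \<in> (\<Union>m. F m)" by blast
  qed
  then have "hausdorff_pre n \<delta> (\<Union>i. A i) \<le> (\<Sum>m. diam_gauge n (F m))"
    by (rule hausdorff_pre_le) (use E(2,3) in \<open>auto simp: F_def split: prod.splits\<close>)
  also have "\<dots> = (\<Sum>i. \<Sum>j. diam_gauge n (E i j))"
    using suminf_ennreal_2dimen[of "\<lambda>i. \<Sum>j. diam_gauge n (E i j)" "\<lambda>(i,j). diam_gauge n (E i j)"]
    by (simp add: F_def comp_def case_prod_beta)
  also have "\<dots> \<le> (\<Sum>i. hausdorff_pre n \<delta> (A i) + ennreal (\<epsilon> * (1/2) ^ Suc i))"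
    by (intro suminf_le le) auto
  also have "\<dots> = (\<Sum>i. hausdorff_pre n \<delta> (A i)) + (\<Sum>i. ennreal (\<epsilon> * (1/2) ^ Suc i))"
    by (rule suminf_add[symmetric]) auto
  also have "(\<Sum>i. ennreal (\<epsilon> * (1/2) ^ Suc i)) = ennreal (\<epsilon> * 1)"
    using sums_mult[OF power_half_series, of \<epsilon>] \<open>0 < \<epsilon>\<close>
    by (intro suminf_ennreal_eq) auto
  finally show "hausdorff_pre n \<delta> (\<Union>i. A i) \<le> (\<Sum>i. hausdorff_pre n \<delta> (A i)) + ennreal \<epsilon>"
    by simp
qed

lemma hausdorff_pre_le_measure: "0 < \<delta> \<Longrightarrow> hausdorff_pre n \<delta> A \<le> hausdorff_measure n A"
  unfolding hausdorff_measure_def by (rule SUP_upper) auto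

lemma hausdorff_measure_mono: "A \<subseteq> B \<Longrightarrow> hausdorff_measure n A \<le> hausdorff_measure n B"
  unfolding hausdorff_measure_def by (intro SUP_mono) (auto intro: hausdorff_pre_mono)

lemma hausdorff_measure_empty [simp]: "hausdorff_measure n {} = 0"
  unfolding hausdorff_measure_def by (auto simp: hausdorff_pre_empty intro!: SUP_eq_const)

lemma hausdorff_measure_UN:
  "hausdorff_measure n (\<Union>i::nat. A i) \<le> (\<Sum>i. hausdorff_measure n (A i))"
  unfolding hausdorff_measure_def[of n "\<Union>i. A i"]
proof (rule SUP_least)
  fix \<delta> :: real assume "\<delta> \<in> {0<..}"
  then have "(\<Sum>i. hausdorff_pre n \<delta> (A i)) \<le> (\<Sum>i. hausdorff_measure n (A i))"
    by (intro suminf_le hausdorff_pre_le_measure) auto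
  with hausdorff_pre_UN show "hausdorff_pre n \<delta> (\<Union>i. A i) \<le> (\<Sum>i. hausdorff_measure n (A i))"
    by (rule order_trans)
qed

lemma hausdorff_measure_Un:
  "hausdorff_measure n (A \<union> B) \<le> hausdorff_measure n A + hausdorff_measure n B"
proof -
  let ?F = "\<lambda>i::nat. if i = 0 then A else if i = 1 then B else {}"
  have "hausdorff_measure n (A \<union> B) \<le> hausdorff_measure n (\<Union>i. ?F i)"
    by (rule hausdorff_measure_mono) (auto split: if_splits intro: exI[of _ 0] exI[of _ 1])
  also have "\<dots> \<le> (\<Sum>i. hausdorff_measure n (?F i))"
    by (rule hausdorff_measure_UN)
  also have "\<dots> = (\<Sum>i\<in>{0, 1::nat}. hausdorff_measure n (?F i))"
    by (rule suminf_finite) auto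
  finally show ?thesis by simp
qed

lemma diameter_affine_le:
  fixes E :: "'a::euclidean_space set"
  assumes "0 \<le> r" "bounded E"
  shows "diameter ((\<lambda>u. v + r *\<^sub>R u) ` E) \<le> r * diameter E"
proof (rule diameter_le)
  show "(\<lambda>u. v + r *\<^sub>R u) ` E \<noteq> {} \<or> 0 \<le> r * diameter E"
    using assms diameter_ge_0 by auto
  fix x y assume "x \<in> (\<lambda>u. v + r *\<^sub>R u) ` E" "y \<in> (\<lambda>u. v + r *\<^sub>R u) ` E"
  then obtain a b where ab: "a \<in> E" "b \<in> E" "x = v + r *\<^sub>R a" "y = v + r *\<^sub>R b" by auto
  then have "norm (x - y) = r * dist a b"
    using assms by (simp add: dist_norm flip: scaleR_diff_right)
  then show "norm (x - y) \<le> r * diameter E"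
    using diameter_bounded_bound[OF assms(2) ab(1,2)] assms(1) by (simp add: mult_left_mono)
qed

text \<open>A cover of mesh \<delta>/r becomes a cover of mesh \<delta> whose gauges grow at most by
  the factor r^n. The inequality is applied in two directions: a dyadic cube is a rescaled unit
  cube, and the unit cube is a rescaled box.\<close>

lemma hausdorff_measure_affine_le:
  fixes A :: "'a::euclidean_space set"
  assumes r: "0 < r"
  shows "hausdorff_measure n ((\<lambda>u. v + r *\<^sub>R u) ` A) \<le> ennreal (r ^ n) * hausdorff_measure n A"
  unfolding hausdorff_measure_def[of n "_ ` A"]
proof (rule SUP_least)
  fix \<delta> :: real assume "\<delta> \<in> {0<..}"
  let ?T = "\<lambda>u. v + r *\<^sub>R u"
  have gauge: "diam_gauge n (?T ` E) \<le> ennreal (r ^ n) * diam_gauge n E" if "bounded E" for E :: "'a set"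
  proof (cases "E = {}")
    case False
    have "unit_ball_vol (real n) * (diameter (?T ` E) / 2) ^ n \<le> unit_ball_vol (real n) * (r * diameter E / 2) ^ n"
      using diameter_affine_le[of r E v] r that diameter_ge_0[OF bounded_translation[OF bounded_scaling[OF that]]]
      by (intro mult_left_mono power_mono) (auto simp: image_image diameter_ge_0)
    also have "\<dots> = r ^ n * (unit_ball_vol (real n) * (diameter E / 2) ^ n)"
      by (simp add: power_mult_distrib power_divide)
    finally show ?thesis
      using False r diameter_ge_0[OF that] by (simp add: diam_gauge_def ennreal_mult[symmetric] ennreal_leI)
  qed simp
  have "hausdorff_pre n \<delta> (?T ` A) \<le> ennreal (r ^ n) * (\<Sum>i. diam_gauge n (E i))"
    if E: "A \<subseteq> (\<Union>i. E i)" "\<And>i. bounded (E i)" "\<And>i. diameter (E i) \<le> \<delta> / r" for E :: "nat \<Rightarrow> 'a set"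
  proof -
    have "hausdorff_pre n \<delta> (?T ` A) \<le> (\<Sum>i. diam_gauge n (?T ` E i))"
    proof (rule hausdorff_pre_le)
      show "?T ` A \<subseteq> (\<Union>i. ?T ` E i)" using E(1) by blast
      show "bounded (?T ` E i)" for i
        using bounded_translation[OF bounded_scaling[OF E(2)]] by (simp add: image_image)
      have "diameter (?T ` E i) \<le> r * diameter (E i)" for i
        using r E by (intro diameter_affine_le) auto
      also have "r * diameter (E i) \<le> \<delta>" for i
        using E(3)[of i] r by (simp add: field_simps)
      finally show "diameter (?T ` E i) \<le> \<delta>" for i .
    qed
    also have "\<dots> \<le> (\<Sum>i. ennreal (r ^ n) * diam_gauge n (E i))"
      by (intro suminf_le gauge E) auto
    finally show ?thesis by simp
  qed
  then have "hausdorff_pre n \<delta> (?T ` A) \<le>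
      (INF E \<in> {E. A \<subseteq> (\<Union>i. E i) \<and> (\<forall>i. bounded (E i) \<and> diameter (E i) \<le> \<delta> / r)}.
         ennreal (r ^ n) * (\<Sum>i. diam_gauge n (E i)))"
    by (intro INF_greatest) auto
  also have "\<dots> = ennreal (r ^ n) * hausdorff_pre n (\<delta> / r) A"
  proof -
    \<comment> \<open>A positive finite factor is invertible in \<open>ennreal\<close>, so it moves
      through any infimum, including the empty one.\<close>
    have "ennreal (r ^ n) * (INF i\<in>I. f i) = (INF i\<in>I. ennreal (r ^ n) * f i)" for I and f :: "(nat \<Rightarrow> 'a set) \<Rightarrow> ennreal"
    proof (rule antisym)
      show "ennreal (r ^ n) * (INF i\<in>I. f i) \<le> (INF i\<in>I. ennreal (r ^ n) * f i)"
        by (intro INF_greatest mult_left_mono INF_lower) auto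
      have "ennreal (inverse (r ^ n)) * (INF i\<in>I. ennreal (r ^ n) * f i) \<le> (INF i\<in>I. f i)"
      proof (rule INF_greatest)
        fix i assume "i \<in> I"
        then have "ennreal (inverse (r ^ n)) * (INF i\<in>I. ennreal (r ^ n) * f i)
            \<le> ennreal (inverse (r ^ n)) * (ennreal (r ^ n) * f i)"
          by (intro mult_left_mono INF_lower) auto
        then show "ennreal (inverse (r ^ n)) * (INF i\<in>I. ennreal (r ^ n) * f i) \<le> f i"
          using r by (simp add: mult.assoc[symmetric] ennreal_mult[symmetric])
      qed
      then have "ennreal (r ^ n) * (ennreal (inverse (r ^ n)) * (INF i\<in>I. ennreal (r ^ n) * f i))
          \<le> ennreal (r ^ n) * (INF i\<in>I. f i)"
        by (rule mult_left_mono) auto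
      then show "(INF i\<in>I. ennreal (r ^ n) * f i) \<le> ennreal (r ^ n) * (INF i\<in>I. f i)"
        using r by (simp add: mult.assoc[symmetric] ennreal_mult[symmetric])
    qed
    then show ?thesis by (simp add: hausdorff_pre_gauge)
  qed
  also have "\<dots> \<le> ennreal (r ^ n) * hausdorff_measure n A"
    using \<open>\<delta> \<in> {0<..}\<close> r by (intro mult_left_mono hausdorff_pre_le_measure) auto
  finally show "hausdorff_pre n \<delta> (?T ` A) \<le> ennreal (r ^ n) * hausdorff_measure n A" .
qed

section \<open>Triangular shears\<close>

abbreviation coord_measure :: "nat \<Rightarrow> (nat \<Rightarrow> real) measure" where
  "coord_measure n \<equiv> Pi\<^sub>M {..<n} (\<lambda>_. lborel)"

interpretation lborel_product: product_sigma_finite "\<lambda>_::nat. lborel :: real measure"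
  by standard

text \<open>The restriction turns the argument of \<open>g k\<close> into a point of
  \<open>coord_measure k\<close>, so that measurability of \<open>g k\<close> can be stated on its
  own space.\<close>

definition triangular_shear :: "nat \<Rightarrow> (nat \<Rightarrow> (nat \<Rightarrow> real) \<Rightarrow> real) \<Rightarrow> (nat \<Rightarrow> real) \<Rightarrow> nat \<Rightarrow> real" where
  "triangular_shear n g x = (\<lambda>k\<in>{..<n}. x k + g k (restrict x {..<k}))"

lemma measurable_triangular_shear:
  assumes "\<And>k. k < n \<Longrightarrow> g k \<in> borel_measurable (coord_measure k)"
  shows "triangular_shear n g \<in> coord_measure n \<rightarrow>\<^sub>M coord_measure n"
  unfolding triangular_shear_def
proof (rule measurable_restrict)
  fix k assume k: "k \<in> {..<n}"
  then have "(\<lambda>x. g k (restrict x {..<k})) \<in> borel_measurable (coord_measure n)"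
    by (intro measurable_compose[OF measurable_restrict_subset assms]) auto
  moreover have "(\<lambda>x. x k) \<in> coord_measure n \<rightarrow>\<^sub>M lborel"
    using k by (rule measurable_component_singleton)
  ultimately show "(\<lambda>x. x k + g k (restrict x {..<k})) \<in> coord_measure n \<rightarrow>\<^sub>M lborel"
    by simp
qed

text \<open>Integrate the last coordinate first: it is translated by a quantity that does not depend on it.\<close>

lemma nn_integral_triangular_shear:
  assumes "\<And>k. k < n \<Longrightarrow> g k \<in> borel_measurable (coord_measure k)"
    and "f \<in> borel_measurable (coord_measure n)"
  shows "(\<integral>\<^sup>+x. f (triangular_shear n g x) \<partial>coord_measure n) = (\<integral>\<^sup>+x. f x \<partial>coord_measure n)"
  using assms
proof (induction n arbitrary: f)
  case 0
  show ?case
    by (rule nn_integral_cong) (auto simp: triangular_shear_def space_PiM PiE_def extensional_def)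
next
  case (Suc n)
  note [measurable] = Suc.prems(2)[unfolded lessThan_Suc]
  have gm: "g k \<in> borel_measurable (coord_measure k)" if "k < n" for k
    using Suc.prems(1) that by simp
  let ?S = "triangular_shear n g"
  have "(\<lambda>x. f (triangular_shear (Suc n) g x)) \<in> borel_measurable (coord_measure (Suc n))"
    by (rule measurable_compose[OF measurable_triangular_shear Suc.prems(2)]) (use Suc.prems(1) in auto)
  then have "(\<integral>\<^sup>+x. f (triangular_shear (Suc n) g x) \<partial>coord_measure (Suc n)) =
      (\<integral>\<^sup>+x. \<integral>\<^sup>+y. f (triangular_shear (Suc n) g (x(n := y))) \<partial>lborel \<partial>coord_measure n)"
    unfolding lessThan_Suc by (intro lborel_product.product_nn_integral_insert) auto
  also have "\<dots> = (\<integral>\<^sup>+x. \<integral>\<^sup>+y. f ((?S x)(n := y)) \<partial>lborel \<partial>coord_measure n)"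
  proof (rule nn_integral_cong)
    fix x assume x: "x \<in> space (coord_measure n)"
    \<comment> \<open>The factor 1 gives the last coordinate the shape expected by
      \<open>nn_integral_real_affine\<close>.\<close>
    have eq: "triangular_shear (Suc n) g (x(n := y)) = (?S x)(n := g n x + 1 * y)" for y
    proof
      fix k
      have "restrict (x(n := y)) {..<k} = restrict x {..<k}" if "k \<le> n"
        using that by (auto simp: restrict_def fun_eq_iff)
      moreover have "restrict x {..<n} = x"
        using x by (auto simp: space_PiM PiE_def extensional_restrict)
      ultimately show "triangular_shear (Suc n) g (x(n := y)) k = ((?S x)(n := g n x + 1 * y)) k"
        by (auto simp: triangular_shear_def)
    qed
    have "?S x \<in> space (coord_measure n)"
      by (rule measurable_space[OF measurable_triangular_shear x]) (use gm in auto)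
    then have "(\<lambda>y. f ((?S x)(n := y))) \<in> borel_measurable borel"
      by measurable
    from nn_integral_real_affine[OF this, of 1 "g n x"]
    show "(\<integral>\<^sup>+y. f (triangular_shear (Suc n) g (x(n := y))) \<partial>lborel) =
        (\<integral>\<^sup>+y. f ((?S x)(n := y)) \<partial>lborel)"
      unfolding eq by simp
  qed
  also have "\<dots> = (\<integral>\<^sup>+x. \<integral>\<^sup>+y. f (x(n := y)) \<partial>lborel \<partial>coord_measure n)"
    by (rule Suc.IH[OF gm]) measurable
  also have "\<dots> = (\<integral>\<^sup>+x. f x \<partial>coord_measure (Suc n))"
    unfolding lessThan_Suc by (rule lborel_product.product_nn_integral_insert[symmetric]) auto
  finally show ?case .
qed

lemma emeasure_triangular_shear:
  assumes g: "\<And>k. k < n \<Longrightarrow> g k \<in> borel_measurable (coord_measure k)"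
    and X: "X \<in> sets (coord_measure n)"
  shows "emeasure (coord_measure n) (triangular_shear n g -` X \<inter> space (coord_measure n)) =
    emeasure (coord_measure n) X"
proof -
  let ?M = "coord_measure n"
  have "triangular_shear n g -` X \<inter> space ?M \<in> sets ?M"
    by (rule measurable_sets[OF measurable_triangular_shear X]) (use g in auto)
  then have "emeasure ?M (triangular_shear n g -` X \<inter> space ?M) =
      (\<integral>\<^sup>+x. indicator (triangular_shear n g -` X \<inter> space ?M) x \<partial>?M)"
    by simp
  also have "\<dots> = (\<integral>\<^sup>+x. indicator X (triangular_shear n g x) \<partial>?M)"
    by (rule nn_integral_cong) (auto split: split_indicator)
  also have "\<dots> = (\<integral>\<^sup>+x. indicator X x \<partial>?M)"
    by (rule nn_integral_triangular_shear) (use g X in auto)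
  finally show ?thesis using X by simp
qed

section \<open>Hausdorff measure on a plane\<close>

text \<open>Dyadic intervals are nested: passing from generation \<open>l\<close> to the coarser
  \<open>k\<close> drops \<open>l - k\<close> binary digits, an integer division of the
  floor.\<close>

lemma floor_pow2_mono:
  fixes a b :: real
  assumes "\<lfloor>2 ^ l * a\<rfloor> = \<lfloor>2 ^ l * b\<rfloor>" "k \<le> l"
  shows "\<lfloor>2 ^ k * a\<rfloor> = \<lfloor>2 ^ k * b\<rfloor>"
proof -
  have "\<lfloor>2 ^ k * c\<rfloor> = \<lfloor>2 ^ l * c\<rfloor> div 2 ^ (l - k)" for c :: real
  proof -
    have "2 ^ k * c = (2 ^ l * c) / real_of_int (2 ^ (l - k))"
      using assms(2) by (auto dest!: le_Suc_ex simp: power_add)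
    then show ?thesis
      using floor_divide_real_eq_div[of "2 ^ (l - k)" "2 ^ l * c"] by simp
  qed
  with assms show ?thesis by simp
qed

lemma countable_disjoint_enum:
  assumes "countable D" "disjoint D"
  obtains A :: "nat \<Rightarrow> 'b set" where "disjoint_family A" "(\<Union>i. A i) = \<Union>D" "\<And>i. A i = {} \<or> A i \<in> D"
proof
  let ?A = "\<lambda>i. if i \<in> to_nat_on D ` D then from_nat_into D i else {}"
  show "?A i = {} \<or> ?A i \<in> D" for i
    by (auto simp: assms)
  show "disjoint_family ?A"
    unfolding disjoint_family_on_def
  proof (intro ballI impI)
    fix i j :: nat assume "i \<noteq> j"
    show "?A i \<inter> ?A j = {}"
    proof (cases "i \<in> to_nat_on D ` D \<and> j \<in> to_nat_on D ` D")
      case True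
      then have "from_nat_into D i \<noteq> from_nat_into D j"
        using \<open>i \<noteq> j\<close> by (metis to_nat_on_from_nat_into)
      moreover have "from_nat_into D i \<in> D" "from_nat_into D j \<in> D"
        using True by (auto intro: from_nat_into)
      ultimately show ?thesis
        using True assms(2) by (simp add: disjoint_def)
    qed auto
  qed
  show "(\<Union>i. ?A i) = \<Union>D"
    using assms(1) by (auto split: if_splits)
qed

section \<open>Orthonormal coordinates and dyadic cubes of a plane\<close>

locale orthonormal_frame =
  fixes e :: "nat \<Rightarrow> 'a::euclidean_space" and n :: nat
  assumes inner_frame: "i < n \<Longrightarrow> j < n \<Longrightarrow> e i \<bullet> e j = (if i = j then 1 else 0)"
begin

abbreviation "M \<equiv> coord_measure n"

definition emb :: "(nat \<Rightarrow> real) \<Rightarrow> 'a" where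
  "emb x = (\<Sum>i<n. x i *\<^sub>R e i)"

definition plane :: "'a set" where
  "plane = emb ` space M"

definition pushed :: "'a set \<Rightarrow> ennreal" where
  "pushed B = emeasure M (emb -` B \<inter> space M)"

text \<open>Half-open dyadic cubes of side 2^-k. Describing them by floors makes the cubes of one
  generation the classes of an equivalence relation, so two of them are equal or disjoint.\<close>

definition cube :: "nat \<Rightarrow> (nat \<Rightarrow> real) \<Rightarrow> (nat \<Rightarrow> real) set" where
  "cube k x = {y \<in> space M. \<forall>i<n. \<lfloor>2 ^ k * y i\<rfloor> = \<lfloor>2 ^ k * x i\<rfloor>}"

lemma space_M: "space M = extensional {..<n}"
  by (auto simp: space_PiM PiE_def)

lemma measurable_emb [measurable]: "emb \<in> borel_measurable M"
  unfolding emb_def by measurable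

lemma norm_frame: "i < n \<Longrightarrow> norm (e i) = 1"
  using inner_frame[of i i] by (simp add: norm_eq_sqrt_inner)

lemma inner_emb: "k < n \<Longrightarrow> emb x \<bullet> e k = x k"
  by (simp add: emb_def inner_sum_left inner_frame if_distrib cong: if_cong)

text \<open>The crude factor \<open>n\<close> in place of its square root is harmless: it serves to
  make small cubes have small images and to keep constants finite.\<close>

lemma emb_diff_le: 
  assumes "\<And>i. i < n \<Longrightarrow> \<bar>x i - y i\<bar> \<le> r"
  shows "norm (emb x - emb y) \<le> real n * r"
proof -
  have "norm (emb x - emb y) = norm (\<Sum>i<n. (x i - y i) *\<^sub>R e i)"
    by (simp add: emb_def sum_subtractf scaleR_diff_left)
  also have "\<dots> \<le> (\<Sum>i<n. r)"
    by (rule sum_norm_le) (use assms norm_frame in auto)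
  finally show ?thesis by simp
qed

lemma norm_emb_le: "(\<And>i. i < n \<Longrightarrow> \<bar>x i\<bar> \<le> r) \<Longrightarrow> norm (emb x) \<le> real n * r"
  using emb_diff_le[of x "\<lambda>_. 0" r] by (simp add: emb_def)

lemma coord_le_norm: "k < n \<Longrightarrow> \<bar>x k\<bar> \<le> norm (emb x)"
  using Cauchy_Schwarz_ineq2[of "emb x" "e k"] by (simp add: inner_emb norm_frame)

lemma emb_affine: "emb (\<lambda>i\<in>{..<n}. a i + r * x i) = emb a + r *\<^sub>R emb x"
  by (simp add: emb_def scaleR_left_distrib sum.distrib scaleR_sum_right)

lemma sets_vimage_emb: "B \<in> sets borel \<Longrightarrow> emb -` B \<inter> space M \<in> sets M"
  by (rule measurable_sets[OF measurable_emb])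

lemma pushed_mono: "A \<subseteq> B \<Longrightarrow> B \<in> sets borel \<Longrightarrow> pushed A \<le> pushed B"
  unfolding pushed_def by (intro emeasure_mono sets_vimage_emb) auto

lemma cube_PiE: "cube k x =
  (\<Pi>\<^sub>E i\<in>{..<n}. {real_of_int \<lfloor>2 ^ k * x i\<rfloor> / 2 ^ k ..< (real_of_int \<lfloor>2 ^ k * x i\<rfloor> + 1) / 2 ^ k})"
proof -
  have "\<lfloor>2 ^ k * (y :: real)\<rfloor> = m \<longleftrightarrow> y \<in> {real_of_int m / 2 ^ k ..< (real_of_int m + 1) / 2 ^ k}" for y m
    by (auto simp: floor_eq_iff field_simps)
  then show ?thesis by (auto simp: cube_def space_M PiE_def)
qed

lemma sets_cube: "cube k x \<in> sets M"
  unfolding cube_PiE by (rule sets_PiM_I_finite) auto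

lemma emeasure_cube: "emeasure M (cube k x) = ennreal (((1/2) ^ k) ^ n)"
proof -
  have "emeasure lborel {a / 2 ^ k ..< (a + 1) / 2 ^ k} = ennreal ((1/2) ^ k)" for a :: real
    by (simp add: divide_right_mono diff_divide_distrib[symmetric] power_one_over)
  then have "emeasure M (cube k x) = (\<Prod>i<n. ennreal ((1/2) ^ k))"
    unfolding cube_PiE by (subst lborel_product.emeasure_PiM) simp_all
  then show ?thesis by (simp add: ennreal_power)
qed

lemma dist_cube: 
  assumes "y \<in> cube k x" "z \<in> cube k x"
  shows "norm (emb y - emb z) \<le> real n * (1/2) ^ k"
proof (rule emb_diff_le)
  fix i assume "i < n"
  with assms have "\<lfloor>2 ^ k * y i\<rfloor> = \<lfloor>2 ^ k * z i\<rfloor>"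
    by (simp add: cube_def)
  moreover have "\<bar>a - b\<bar> \<le> 1" if "\<lfloor>a\<rfloor> = \<lfloor>b\<rfloor>" for a b :: real
    using that by linarith
  ultimately have "\<bar>2 ^ k * y i - 2 ^ k * z i\<bar> \<le> 1"
    by blast
  also have "\<bar>2 ^ k * y i - 2 ^ k * z i\<bar> = 2 ^ k * \<bar>y i - z i\<bar>"
    by (simp add: abs_mult flip: right_diff_distrib)
  finally show "\<bar>y i - z i\<bar> \<le> (1/2) ^ k"
    by (simp add: field_simps)
qed

lemma bounded_emb_cube: "bounded (emb ` cube k x)"
  unfolding bounded_two_points
  by (rule exI[of _ "real n * (1/2) ^ k"]) (auto simp: dist_norm intro!: dist_cube)

lemma diameter_emb_cube: "diameter (emb ` cube k x) \<le> real n * (1/2) ^ k"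
  by (rule diameter_le) (auto simp: dist_cube)

section \<open>Dyadic decomposition and covering bounds for open sets\<close>

lemma pow_half_small:
  fixes \<epsilon> :: real
  assumes "0 < \<epsilon>" shows "\<exists>k\<ge>k0. real n * (1/2) ^ k < \<epsilon>"
proof -
  have "(\<lambda>k. real n * (1/2) ^ k) \<longlonglongrightarrow> real n * 0"
    by (intro tendsto_mult tendsto_const LIMSEQ_power_zero) auto
  then have "eventually (\<lambda>k. real n * (1/2) ^ k < \<epsilon>) sequentially"
    using order_tendstoD(2)[of _ "real n * 0" sequentially \<epsilon>] assms by simp
  then show ?thesis
    unfolding eventually_sequentially by (meson nle_le)
qed

text \<open>The maximal dyadic cubes of generation at least \<open>k0\<close> contained in \<open>X\<close> partition \<open>X\<close>.\<close>

lemma dyadic_decomposition: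
  assumes X: "X \<subseteq> space M" and small: "\<And>x. x \<in> X \<Longrightarrow> \<exists>k\<ge>k0. cube k x \<subseteq> X"
  obtains A :: "nat \<Rightarrow> (nat \<Rightarrow> real) set" where "disjoint_family A" "(\<Union>i. A i) = X"
    "\<And>i. A i = {} \<or> (\<exists>x. \<exists>k\<ge>k0. A i = cube k x)"
proof -
  define gen where "gen x = (LEAST k. k0 \<le> k \<and> cube k x \<subseteq> X)" for x
  have gen: "k0 \<le> gen x" "cube (gen x) x \<subseteq> X" if "x \<in> X" for x
    using LeastI_ex[of "\<lambda>k. k0 \<le> k \<and> cube k x \<subseteq> X"] small[OF that] by (auto simp: gen_def)
  have gen_le: "gen x \<le> k" if "k0 \<le> k" "cube k x \<subseteq> X" for x k
    unfolding gen_def by (rule Least_le) (use that in simp)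
  have self: "x \<in> cube k x" if "x \<in> X" for x k
    using X that by (auto simp: cube_def)
  have same: "cube l z = cube l x" if "z \<in> cube k x" "l \<le> k" for x z k l
  proof -
    have "\<lfloor>2 ^ l * z i\<rfloor> = \<lfloor>2 ^ l * x i\<rfloor>" if "i < n" for i
      using \<open>z \<in> cube k x\<close> that by (intro floor_pow2_mono[OF _ \<open>l \<le> k\<close>]) (simp add: cube_def)
    then show ?thesis by (simp add: cube_def)
  qed
  \<comment> \<open>If two chosen cubes meet, the coarser one is also the cube of \<open>y\<close>
    of that generation and lies in \<open>X\<close>, so minimality of \<open>gen y\<close> forces
    equal generations.\<close>
  have eq: "cube (gen x) x = cube (gen y) y"
    if "x \<in> X" "y \<in> X" "z \<in> cube (gen x) x" "z \<in> cube (gen y) y" "gen x \<le> gen y" for x y z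
  proof -
    have "cube (gen x) y = cube (gen x) x"
      using same[OF that(4,5)] same[OF that(3) order_refl] by simp
    then have "gen y \<le> gen x"
      using gen[OF that(1)] by (intro gen_le) auto
    with that(5) \<open>cube (gen x) y = cube (gen x) x\<close> show ?thesis by simp
  qed
  define D where "D = (\<lambda>x. cube (gen x) x) ` X"
  have disj: "disjoint D"
    unfolding D_def disjoint_def by (auto dest: eq) (metis (no_types, lifting) eq nle_le)+
  \<comment> \<open>A chosen cube is coded by its generation and the integer coordinates of its
    corner.\<close>
  have cnt: "countable D"
  proof -
    let ?c = "\<lambda>(k, m). {y \<in> space M. \<forall>i<n. \<lfloor>2 ^ k * y i\<rfloor> = m i}"
    have c: "cube (gen x) x = ?c (gen x, \<lambda>i\<in>{..<n}. \<lfloor>2 ^ gen x * x i\<rfloor>)" for x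
      by (auto simp: cube_def)
    have "D \<subseteq> ?c ` (UNIV \<times> (\<Pi>\<^sub>E i\<in>{..<n}. UNIV))"
      unfolding D_def by (intro image_subsetI) (rule image_eqI, rule c, auto)
    moreover have "countable ((UNIV::nat set) \<times> (\<Pi>\<^sub>E i\<in>{..<n}. (UNIV::int set)))"
      by (intro countable_SIGMA countable_PiE) auto
    ultimately show ?thesis by (meson countable_image countable_subset)
  qed
  obtain A where A: "disjoint_family A" "(\<Union>i. A i) = \<Union>D" "\<And>i::nat. A i = {} \<or> A i \<in> D"
    using countable_disjoint_enum[OF cnt disj] by blast
  show ?thesis
  proof (rule that[OF A(1)])
    show "(\<Union>i. A i) = X"
      unfolding A(2) D_def using gen(2) self by blast
    show "A i = {} \<or> (\<exists>x. \<exists>k\<ge>k0. A i = cube k x)" for i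
      using A(3)[of i] gen(1) unfolding D_def by blast
  qed
qed

text \<open>Subadditivity of \<open>f\<close> meets additivity of Lebesgue measure on disjoint cubes
  that fill \<open>U\<close>. The set function is kept abstract because there are two uses:
  \<open>hausdorff_pre\<close>, where \<open>k0\<close> excludes cubes too large for the mesh, and
  \<open>hausdorff_measure\<close>, where every cube qualifies.\<close>

lemma open_bound:
  fixes f :: "'a set \<Rightarrow> ennreal"
  assumes "f {} = 0" and sub: "\<And>A :: nat \<Rightarrow> 'a set. f (\<Union>i. A i) \<le> (\<Sum>i. f (A i))"
    and cubes: "\<And>k x. k0 \<le> k \<Longrightarrow> f (emb ` cube k x) \<le> C * emeasure M (cube k x)"
    and "open U"
  shows "f (U \<inter> plane) \<le> C * pushed U"
proof -
  let ?X = "emb -` U \<inter> space M"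
  have "\<exists>k\<ge>k0. cube k x \<subseteq> ?X" if x: "x \<in> ?X" for x
  proof -
    obtain \<epsilon> where \<epsilon>: "0 < \<epsilon>" "ball (emb x) \<epsilon> \<subseteq> U"
      using \<open>open U\<close> x by (auto elim: openE)
    obtain k where k: "k \<ge> k0" "real n * (1/2) ^ k < \<epsilon>"
      using pow_half_small \<epsilon>(1) by blast
    have "emb y \<in> ball (emb x) \<epsilon>" if "y \<in> cube k x" for y
      using dist_cube[of x k x y] that x k(2) by (auto simp: dist_norm cube_def)
    moreover have "cube k x \<subseteq> space M"
      by (auto simp: cube_def)
    ultimately have "cube k x \<subseteq> ?X"
      using \<epsilon>(2) by blast
    with k(1) show ?thesis by blast
  qed
  then obtain A where A: "disjoint_family A" "(\<Union>i. A i) = ?X"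
    "\<And>i::nat. A i = {} \<or> (\<exists>x. \<exists>k\<ge>k0. A i = cube k x)"
    using dyadic_decomposition[of ?X k0] by blast
  have "U \<inter> plane = (\<Union>i. emb ` A i)"
    unfolding image_UN[symmetric] A(2) by (auto simp: plane_def)
  then have "f (U \<inter> plane) \<le> (\<Sum>i. f (emb ` A i))"
    using sub by simp
  also have "\<dots> \<le> (\<Sum>i. C * emeasure M (A i))"
  proof (intro suminf_le)
    show "f (emb ` A i) \<le> C * emeasure M (A i)" for i
      using A(3)[of i] cubes \<open>f {} = 0\<close> by auto
  qed auto
  also have "\<dots> = C * (\<Sum>i. emeasure M (A i))"
    by simp
  also have "(\<Sum>i. emeasure M (A i)) = emeasure M (\<Union>i. A i)"
  proof (rule suminf_emeasure)
    show "range A \<subseteq> sets M" using A(3) sets_cube by (metis image_subsetI sets.empty_sets)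
  qed (rule A(1))
  also have "\<dots> = pushed U"
    by (simp add: pushed_def A(2))
  finally show ?thesis .
qed

lemma pushed_bounded_finite: "bounded B \<Longrightarrow> pushed B < \<infinity>"
proof -
  assume "bounded B"
  then obtain R where R: "\<And>u. u \<in> B \<Longrightarrow> norm u \<le> R"
    unfolding bounded_iff by blast
  have "pushed B \<le> emeasure M (\<Pi>\<^sub>E i\<in>{..<n}. {-R..R})"
    unfolding pushed_def
  proof (rule emeasure_mono)
    show "emb -` B \<inter> space M \<subseteq> (\<Pi>\<^sub>E i\<in>{..<n}. {-R..R})"
    proof
      fix x assume x: "x \<in> emb -` B \<inter> space M"
      have "x i \<in> {-R..R}" if "i < n" for i
        using coord_le_norm[OF that, of x] R[of "emb x"] x by auto
      then show "x \<in> (\<Pi>\<^sub>E i\<in>{..<n}. {-R..R})"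
        using x by (auto simp: space_M PiE_def)
    qed
  qed (auto intro: sets_PiM_I_finite)
  also have "\<dots> < \<infinity>"
    by (subst lborel_product.emeasure_PiM) (auto simp: power_eq_top_ennreal less_top[symmetric] emeasure_lborel_Icc_eq)
  finally show ?thesis .
qed

section \<open>Comparison of Hausdorff and Lebesgue measure on the plane\<close>

definition density_const :: ennreal where
  "density_const = hausdorff_measure n (emb ` cube 0 (\<lambda>_. 0))"

lemma unit_cube: "cube 0 (\<lambda>_. 0) = (\<Pi>\<^sub>E i\<in>{..<n}. {0..<1})"
  by (simp add: cube_PiE)

text \<open>The gauge of a dyadic cube is at most a fixed multiple of its volume. Filling a bounded
  open neighbourhood of the unit cube with small cubes therefore bounds \<open>hausdorff_pre\<close>
  independently of the mesh.\<close>

lemma density_const_finite: "density_const < \<infinity>"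
proof -
  \<comment> \<open>The gauge of a set of diameter \<open>n\<close>, the diameter bound for the unit
    cube. A cube of generation \<open>k\<close> scales both this gauge and its volume by
    2^(-kn).\<close>
  let ?C = "ennreal (unit_ball_vol n * (real n / 2) ^ n)"
  \<comment> \<open>Points of the unit cube have norm at most \<open>n\<close>, so this radius
    leaves room for an open ball.\<close>
  let ?U = "ball (0::'a) (real n + 1)"
  have "hausdorff_pre n \<delta> (?U \<inter> plane) \<le> ?C * pushed ?U" if \<delta>: "0 < \<delta>" for \<delta>
  proof -
    obtain k0 where k0: "real n * (1/2) ^ k0 < \<delta>"
      using pow_half_small[OF \<delta>, of 0] by auto
    show ?thesis
    proof (rule open_bound[of _ k0])
      show "hausdorff_pre n \<delta> (emb ` cube k x) \<le> ?C * emeasure M (cube k x)" if k: "k0 \<le> k" for k x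
      proof -
        have "real n * (1/2) ^ k \<le> real n * (1/2) ^ k0"
          using k by (intro mult_left_mono power_decreasing) auto
        then have "hausdorff_pre n \<delta> (emb ` cube k x) \<le> diam_gauge n (emb ` cube k x)"
          using diameter_emb_cube[of k x] k0 \<delta> by (intro hausdorff_pre_single bounded_emb_cube) auto
        also have "\<dots> \<le> ennreal (unit_ball_vol n * (real n * (1/2) ^ k / 2) ^ n)"
          using diameter_emb_cube[of k x] diameter_ge_0[OF bounded_emb_cube, of k x]
          by (auto simp: diam_gauge_def intro!: ennreal_leI mult_left_mono power_mono divide_right_mono)
        also have "\<dots> = ?C * emeasure M (cube k x)"
          by (simp add: emeasure_cube ennreal_mult[symmetric] power_mult_distrib power_divide mult_ac)
        finally show ?thesis .
      qed
    qed (use \<delta> in \<open>auto intro: hausdorff_pre_UN hausdorff_pre_empty\<close>)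
  qed
  then have "hausdorff_measure n (?U \<inter> plane) \<le> ?C * pushed ?U"
    unfolding hausdorff_measure_def by (intro SUP_least) auto
  also have "\<dots> < \<infinity>"
    using pushed_bounded_finite[of ?U] by (simp add: ennreal_mult_less_top)
  finally have "hausdorff_measure n (?U \<inter> plane) < \<infinity>" .
  moreover have "emb ` cube 0 (\<lambda>_. 0) \<subseteq> ?U \<inter> plane"
  proof -
    have "norm (emb x) < real n + 1" if x: "x \<in> cube 0 (\<lambda>_. 0)" for x
    proof -
      have "\<bar>x i\<bar> \<le> 1" if "i < n" for i
        using PiE_mem[of x "{..<n}" "\<lambda>_. {0..<1}" i] x that by (simp add: unit_cube)
      then have "norm (emb x) \<le> real n * 1" by (rule norm_emb_le)
      then show ?thesis by simp
    qed
    then show ?thesis by (auto simp: plane_def cube_def)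
  qed
  ultimately show ?thesis
    unfolding density_const_def by (meson hausdorff_measure_mono order_le_less_trans)
qed

text \<open>Every dyadic cube is a translated and rescaled unit cube, so scaling bounds its
  Hausdorff measure by \<open>density_const\<close> times its volume, and \<open>open_bound\<close>
  passes to open sets.\<close>

lemma hausdorff_open_le:
  assumes "open U"
  shows "hausdorff_measure n (U \<inter> plane) \<le> density_const * pushed U"
proof (rule open_bound[OF _ _ _ assms])
  fix k :: nat and x :: "nat \<Rightarrow> real"
  \<comment> \<open>\<open>?m\<close> is the lower corner of the cube; \<open>?q\<close> below gives
    the position relative to this corner, measured in side lengths.\<close>
  let ?m = "\<lambda>i. real_of_int \<lfloor>2 ^ k * x i\<rfloor> / 2 ^ k"
  have "emb ` cube k x \<subseteq> (\<lambda>u. emb ?m + (1/2) ^ k *\<^sub>R u) ` emb ` cube 0 (\<lambda>_. 0)"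
  proof
    fix u assume "u \<in> emb ` cube k x"
    then obtain y where y: "y \<in> cube k x" "u = emb y" by blast
    let ?q = "\<lambda>i\<in>{..<n}. 2 ^ k * y i - real_of_int \<lfloor>2 ^ k * x i\<rfloor>"
    have "?q \<in> cube 0 (\<lambda>_. 0)"
      using y(1) by (auto simp: unit_cube cube_def PiE_iff space_M)
    moreover have "y \<in> extensional {..<n}"
      using y(1) by (simp add: cube_def space_M)
    then have "y = (\<lambda>i\<in>{..<n}. ?m i + (1/2) ^ k * ?q i)"
      by (rule extensionalityI[OF _ restrict_extensional]) (simp add: field_simps)
    then have "u = emb ?m + (1/2) ^ k *\<^sub>R emb ?q"
      unfolding y(2) emb_affine[symmetric] by (rule arg_cong)
    ultimately show "u \<in> (\<lambda>u. emb ?m + (1/2) ^ k *\<^sub>R u) ` emb ` cube 0 (\<lambda>_. 0)" by blast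
  qed
  then have "hausdorff_measure n (emb ` cube k x) \<le> ennreal (((1/2) ^ k) ^ n) * density_const"
    unfolding density_const_def
    by (rule order_trans[OF hausdorff_measure_mono hausdorff_measure_affine_le]) auto
  then show "hausdorff_measure n (emb ` cube k x) \<le> density_const * emeasure M (cube k x)"
    by (simp add: emeasure_cube mult.commute)
qed (auto intro: hausdorff_measure_UN)

text \<open>Outer regularity replaces \<open>B\<close> by an open superset with nearly the same
  Lebesgue measure, to which the bound for open sets applies.\<close>

lemma hausdorff_borel_le:
  assumes B: "B \<in> sets borel" and bdd: "bounded (B \<inter> plane)"
  shows "hausdorff_measure n (B \<inter> plane) \<le> density_const * pushed B"
proof -
  obtain R where R: "B \<inter> plane \<subseteq> ball 0 R"
    using bounded_subset_ballD[OF bdd] by blast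
  let ?B = "B \<inter> ball 0 R" and ?P = "distr M borel emb"
  \<comment> \<open>Outer regularity is invoked for a finite measure, so Lebesgue measure on the
    plane is cut down to a ball that contains the set.\<close>
  let ?N = "density ?P (indicator (ball 0 R))"
  have P: "emeasure ?P X = pushed X" if "X \<in> sets borel" for X
    using that by (simp add: emeasure_distr pushed_def)
  have N: "emeasure ?N X = pushed (ball 0 R \<inter> X)" if "X \<in> sets borel" for X
    using that by (subst emeasure_restricted) (auto simp: P)
  have NB: "emeasure ?N ?B = pushed ?B"
    by (subst N) (use B in \<open>auto intro!: arg_cong[where f = pushed]\<close>)
  have "emeasure ?N (space ?N) \<noteq> \<infinity>"
    using N[of UNIV] pushed_bounded_finite[of "ball 0 R"] by simp
  then have outer: "emeasure ?N ?B = (INF U \<in> {U. ?B \<subseteq> U \<and> open U}. emeasure ?N U)"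
    by (intro outer_regular) (use B in auto)
  have "hausdorff_measure n (B \<inter> plane) \<le> density_const * (pushed B + ennreal \<epsilon>)" if "0 < \<epsilon>" for \<epsilon>
  proof -
    have "emeasure ?N ?B < emeasure ?N ?B + ennreal \<epsilon>"
      using pushed_bounded_finite[of ?B] that unfolding NB
      by (auto simp: less_top[symmetric] intro!: ennreal_add_left_cancel_less[THEN iffD2, of _ 0, simplified])
    then obtain U where U: "?B \<subseteq> U" "open U" "emeasure ?N U < emeasure ?N ?B + ennreal \<epsilon>"
      unfolding outer[symmetric] by (subst (asm) (1) outer) (auto simp: INF_less_iff)
    have "hausdorff_measure n (B \<inter> plane) \<le> hausdorff_measure n ((ball 0 R \<inter> U) \<inter> plane)"
      by (rule hausdorff_measure_mono) (use R U(1) in auto)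
    also have "\<dots> \<le> density_const * pushed (ball 0 R \<inter> U)"
      by (rule hausdorff_open_le) (use U(2) in auto)
    also have "pushed (ball 0 R \<inter> U) \<le> emeasure ?N ?B + ennreal \<epsilon>"
      using U N[of U] by auto
    also have "emeasure ?N ?B \<le> pushed B"
      unfolding NB using B by (intro pushed_mono) auto
    finally show ?thesis by (simp add: mult_left_mono add_right_mono)
  qed
  note * = this
  show ?thesis
  proof (rule ennreal_le_epsilon)
    fix \<epsilon> :: real assume "0 < \<epsilon>"
    obtain c where c: "density_const = ennreal c" "0 \<le> c"
      using density_const_finite by (cases density_const) auto
    \<comment> \<open>Dividing by \<open>c + 1\<close> rather than \<open>c\<close> also covers a
      vanishing constant.\<close>
    have "density_const * ennreal (\<epsilon> / (c + 1)) \<le> ennreal \<epsilon>"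
      using c \<open>0 < \<epsilon>\<close> by (auto simp: ennreal_mult[symmetric] field_simps intro!: ennreal_leI)
    then show "hausdorff_measure n (B \<inter> plane) \<le> density_const * pushed B + ennreal \<epsilon>"
      using *[of "\<epsilon> / (c + 1)"] c \<open>0 < \<epsilon>\<close>
      by (auto simp: distrib_left intro: order_trans add_left_mono)
  qed
qed

text \<open>The lower bound follows by applying the upper bound to the complement in a large box,
  whose Hausdorff measure is known by scaling.\<close>

lemma hausdorff_borel_eq:
  assumes B: "B \<in> sets borel" and bdd: "bounded (B \<inter> plane)"
  shows "hausdorff_measure n (B \<inter> plane) = density_const * pushed B"
proof (rule antisym[OF hausdorff_borel_le[OF assms]])
  obtain R where R: "0 < R" "B \<inter> plane \<subseteq> ball 0 R"
    using bounded_subset_ballD[OF bdd] by blast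
  \<comment> \<open>A cylinder in the ambient space over a half-open cube of side 2R in the plane.
    Half-open faces make its trace on the plane an exact rescaling of the unit cube.\<close>
  define W where "W = {u. \<forall>i<n. -R \<le> u \<bullet> e i \<and> u \<bullet> e i < R}"
  let ?Q = "\<Pi>\<^sub>E i\<in>{..<n}. {-R..<R}"
  have W_borel: "W \<in> sets borel"
    unfolding W_def by measurable
  have W_vimage: "emb -` W \<inter> space M = ?Q"
    by (rule set_eqI) (simp add: W_def inner_emb space_M PiE_iff conj_commute Ball_def)
  have W_plane: "W \<inter> plane = emb ` ?Q"
    unfolding W_vimage[symmetric] plane_def by blast
  have norm_W: "norm u \<le> real n * R" if u: "u \<in> W \<inter> plane" for u
  proof -
    obtain x where "x \<in> ?Q" "u = emb x" using u W_plane by blast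
    moreover have "\<bar>x i\<bar> \<le> R" if "i < n" for i
      using PiE_mem[OF \<open>x \<in> ?Q\<close>, of i] that by auto
    ultimately show ?thesis using norm_emb_le by blast
  qed
  have B_W: "B \<inter> plane \<subseteq> W"
  proof
    fix u assume u: "u \<in> B \<inter> plane"
    then have "norm u < R" using R(2) by auto
    then have "\<bar>u \<bullet> e i\<bar> < R" if "i < n" for i
      using Cauchy_Schwarz_ineq2[of u "e i"] norm_frame[OF that] by simp
    then have "- R \<le> u \<bullet> e i \<and> u \<bullet> e i < R" if "i < n" for i
      using that by (meson abs_less_iff less_imp_le minus_le_iff)
    then show "u \<in> W" by (simp add: W_def)
  qed
  have pushed_W: "pushed W = ennreal ((2 * R) ^ n)"
    unfolding pushed_def W_vimage using R(1)
    by (subst lborel_product.emeasure_PiM) (auto simp: ennreal_power)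
  have "density_const \<le> ennreal ((1 / (2 * R)) ^ n) * hausdorff_measure n (W \<inter> plane)"
  proof -
    \<comment> \<open>The box is centred at the origin; shrinking its side 2R to 1 and shifting
      every coordinate by 1/2 gives the unit cube.\<close>
    have "emb ` cube 0 (\<lambda>_. 0) \<subseteq> (\<lambda>u. emb (\<lambda>_. 1/2) + (1 / (2 * R)) *\<^sub>R u) ` (W \<inter> plane)"
    proof
      fix u assume "u \<in> emb ` cube 0 (\<lambda>_. 0)"
      then obtain q where q: "q \<in> cube 0 (\<lambda>_. 0)" "u = emb q" by blast
      let ?b = "\<lambda>i\<in>{..<n}. 2 * R * (q i - 1/2)"
      have "-R \<le> 2 * R * (t - 1/2) \<and> 2 * R * (t - 1/2) < R" if "0 \<le> t" "t < 1" for t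
        using that R(1) mult_strict_left_mono[of t 1 R] by (simp add: algebra_simps)
      then have "?b \<in> ?Q"
        using q(1) by (auto simp: unit_cube PiE_iff)
      then have "emb ?b \<in> W \<inter> plane" using W_plane by blast
      moreover have "q \<in> extensional {..<n}"
        using q(1) by (simp add: cube_def space_M)
      then have "q = (\<lambda>i\<in>{..<n}. 1/2 + (1 / (2 * R)) * ?b i)"
        by (rule extensionalityI[OF _ restrict_extensional]) (use R(1) in simp)
      then have "u = emb (\<lambda>_. 1/2) + (1 / (2 * R)) *\<^sub>R emb ?b"
        unfolding q(2) emb_affine[symmetric] by (rule arg_cong)
      ultimately show "u \<in> (\<lambda>u. emb (\<lambda>_. 1/2) + (1 / (2 * R)) *\<^sub>R u) ` (W \<inter> plane)" by blast
    qed
    then show ?thesis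
      unfolding density_const_def
      by (rule order_trans[OF hausdorff_measure_mono hausdorff_measure_affine_le]) (use R(1) in auto)
  qed
  then have "ennreal ((2 * R) ^ n) * density_const \<le>
      ennreal ((2 * R) ^ n) * (ennreal ((1 / (2 * R)) ^ n) * hausdorff_measure n (W \<inter> plane))"
    by (rule mult_left_mono) auto
  also have "\<dots> = hausdorff_measure n (W \<inter> plane)"
  proof -
    have "(2 * R) ^ n * (1 / (2 * R)) ^ n = (2 * R * (1 / (2 * R))) ^ n"
      by (rule power_mult_distrib[symmetric])
    also have "\<dots> = 1"
      using R(1) by simp
    finally have "ennreal ((2 * R) ^ n) * ennreal ((1 / (2 * R)) ^ n) = 1"
      using R(1) by (subst ennreal_mult[symmetric]) (simp_all only: ennreal_1, simp_all)
    then show ?thesis by (simp only: mult.assoc[symmetric] mult_1)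
  qed
  also have "\<dots> \<le> hausdorff_measure n ((B \<inter> plane) \<union> ((W - B) \<inter> plane))"
    by (rule hausdorff_measure_mono) auto
  also have "\<dots> \<le> hausdorff_measure n (B \<inter> plane) + hausdorff_measure n ((W - B) \<inter> plane)"
    by (rule hausdorff_measure_Un)
  also have "hausdorff_measure n ((W - B) \<inter> plane) \<le> density_const * pushed (W - B)"
    using W_borel B norm_W by (intro hausdorff_borel_le) (auto simp: bounded_iff)
  finally have le: "density_const * pushed W \<le> hausdorff_measure n (B \<inter> plane) + density_const * pushed (W - B)"
    by (simp add: pushed_W mult.commute add_left_mono)
  have "pushed W = pushed B + pushed (W - B)"
  proof -
    have "emb -` W \<inter> space M = (emb -` B \<inter> space M) \<union> (emb -` (W - B) \<inter> space M)"
      using B_W by (auto simp: plane_def)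
    moreover have "(emb -` B \<inter> space M) \<inter> (emb -` (W - B) \<inter> space M) = {}" by auto
    ultimately show ?thesis
      unfolding pushed_def using B W_borel by (metis plus_emeasure sets_vimage_emb sets.Diff)
  qed
  \<comment> \<open>Finiteness is what allows the share of \<open>W - B\<close> to be cancelled from
    both sides of \<open>le\<close>.\<close>
  moreover have "density_const * pushed (W - B) < \<infinity>"
  proof -
    have "pushed (W - B) \<le> pushed W" using W_borel by (intro pushed_mono) auto
    then have "pushed (W - B) < \<infinity>" by (simp add: pushed_W le_less_trans)
    then show ?thesis using density_const_finite by (simp add: ennreal_mult_less_top)
  qed
  ultimately show "density_const * pushed B \<le> hausdorff_measure n (B \<inter> plane)"
    using le by (auto simp: distrib_left ennreal_add_left_cancel_le add.commute)
qed

lemma plane_eq_span: "plane = span (e ` {..<n})"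
proof
  show "plane \<subseteq> span (e ` {..<n})"
    unfolding plane_def emb_def by (intro image_subsetI span_sum span_scale) (simp add: span_base)
  have inj: "inj_on e {..<n}"
    using inner_frame by (metis (no_types) inj_onI lessThan_iff zero_neq_one)
  have "v \<in> plane" if v: "v \<in> span (e ` {..<n})" for v
  proof -
    obtain c where "v = (\<Sum>b\<in>e ` {..<n}. c b *\<^sub>R b)"
      using v unfolding span_finite[OF finite_imageI[OF finite_lessThan]] by blast
    also have "\<dots> = emb (\<lambda>i\<in>{..<n}. c (e i))"
      by (simp add: emb_def sum.reindex[OF inj])
    finally show ?thesis by (simp add: plane_def space_M)
  qed
  then show "span (e ` {..<n}) \<subseteq> plane" by blast
qed

end

section \<open>Graded groups\<close>

context graded_group begin

section \<open>Layer projections\<close>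

abbreviation P where "P \<equiv> layer_proj H \<iota>"

lemma P_decomp: "(\<lambda>j\<in>{1..\<iota>}. P j x) \<in> (\<Pi>\<^sub>E i\<in>{1..\<iota>}. H i)"
  and P_sum: "x = (\<Sum>i\<in>{1..\<iota>}. P i x)"
proof -
  let ?c = "THE c. c \<in> (\<Pi>\<^sub>E i\<in>{1..\<iota>}. H i) \<and> x = (\<Sum>i\<in>{1..\<iota>}. c i)"
  have c: "?c \<in> (\<Pi>\<^sub>E i\<in>{1..\<iota>}. H i) \<and> x = (\<Sum>i\<in>{1..\<iota>}. ?c i)"
    using direct_sum by (rule theI')
  have P: "P j x = ?c j" for j by (simp add: layer_proj_def)
  have "(\<lambda>j\<in>{1..\<iota>}. P j x) = ?c"
    unfolding P using c by (auto simp: PiE_def extensional_restrict)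
  with c show "(\<lambda>j\<in>{1..\<iota>}. P j x) \<in> (\<Pi>\<^sub>E i\<in>{1..\<iota>}. H i)" by simp
  show "x = (\<Sum>i\<in>{1..\<iota>}. P i x)" unfolding P using c by blast
qed

lemma P_layer: "j \<in> {1..\<iota>} \<Longrightarrow> P j x \<in> H j"
  using PiE_mem[OF P_decomp, of j] by simp

lemma P_unique:
  assumes "\<And>i. i \<in> {1..\<iota>} \<Longrightarrow> c i \<in> H i" "x = (\<Sum>i\<in>{1..\<iota>}. c i)" "j \<in> {1..\<iota>}"
  shows "P j x = c j"
proof -
  have 1: "restrict c {1..\<iota>} \<in> (\<Pi>\<^sub>E i\<in>{1..\<iota>}. H i) \<and> x = (\<Sum>i\<in>{1..\<iota>}. restrict c {1..\<iota>} i)"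
    using assms(1,2) by auto
  have 2: "restrict (\<lambda>j. P j x) {1..\<iota>} \<in> (\<Pi>\<^sub>E i\<in>{1..\<iota>}. H i) \<and> x = (\<Sum>i\<in>{1..\<iota>}. restrict (\<lambda>j. P j x) {1..\<iota>} i)"
    using P_decomp[of x] P_sum[of x] by simp
  from ex1E[OF direct_sum[of x]] 1 2
  have "restrict (\<lambda>j. P j x) {1..\<iota>} = restrict c {1..\<iota>}" by metis
  from fun_cong[OF this, of j] assms(3) show ?thesis by simp
qed

lemma P_of_layer:
  assumes "x \<in> H k" "k \<in> {1..\<iota>}" "j \<in> {1..\<iota>}"
  shows "P j x = (if j = k then x else 0)"
proof (rule P_unique)
  show "(if i = k then x else 0) \<in> H i" if "i \<in> {1..\<iota>}" for i
    using assms(1) that layer_subspace[of i] by (auto intro: subspace_0)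
qed (use assms in auto)

lemma linear_P: "j \<in> {1..\<iota>} \<Longrightarrow> linear (P j)"
proof (rule linearI)
  assume j: "j \<in> {1..\<iota>}"
  fix x y and r :: real
  show "P j (x + y) = P j x + P j y"
  proof (rule P_unique[OF _ _ j])
    show "P i x + P i y \<in> H i" if "i \<in> {1..\<iota>}" for i
      using that layer_subspace[of i] P_layer by (simp add: subspace_add)
    show "x + y = (\<Sum>i\<in>{1..\<iota>}. P i x + P i y)"
      using P_sum[of x] P_sum[of y] by (simp add: sum.distrib)
  qed
  show "P j (r *\<^sub>R x) = r *\<^sub>R P j x"
  proof (rule P_unique[OF _ _ j])
    show "r *\<^sub>R P i x \<in> H i" if "i \<in> {1..\<iota>}" for i
      using that layer_subspace[of i] P_layer by (simp add: subspace_scale)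
    show "r *\<^sub>R x = (\<Sum>i\<in>{1..\<iota>}. r *\<^sub>R P i x)"
      using P_sum[of x] by (metis scaleR_sum_right)
  qed
qed

lemma norm_le_sum_P: "norm x \<le> (\<Sum>j\<in>{1..\<iota>}. norm (P j x))"
  by (subst P_sum) (rule norm_sum)

lemma P_dilation:
  assumes "j \<in> {1..\<iota>}" shows "P j (dilation H \<iota> r x) = r ^ j *\<^sub>R P j x"
proof (rule P_unique[OF _ dilation_def assms])
  show "r ^ i *\<^sub>R P i x \<in> H i" if "i \<in> {1..\<iota>}" for i
    using that layer_subspace[of i] P_layer by (simp add: subspace_scale)
qed

lemma dilation_0 [simp]: "dilation H \<iota> r 0 = 0"
  unfolding dilation_def by (rule sum.neutral) (simp add: linear_0[OF linear_P])

section \<open>The descending filtration by sums of the layers from \<open>j\<close> upwards\<close>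

definition tail :: "nat \<Rightarrow> 'a set" where
  "tail j = {x. \<forall>i\<in>{1..\<iota>}. i < j \<longrightarrow> P i x = 0}"

lemma subspace_tail: "subspace (tail j)"
  by (auto simp: subspace_def tail_def linear_0[OF linear_P] linear_add[OF linear_P] linear_scale[OF linear_P])

lemma tail_1: "x \<in> tail 1"
  by (simp add: tail_def)

lemma tail_Suc: "tail (Suc j) \<subseteq> tail j"
  by (auto simp: tail_def)

text \<open>Congruence modulo \<open>tail (Suc j)\<close> is agreement in the layers 1 to
  \<open>j\<close>; statements about what a component depends on are phrased through such
  congruences.\<close>

lemma P_eq_of_tail: 
  assumes "x - y \<in> tail (Suc j)" "j \<in> {1..\<iota>}" shows "P j x = P j y"
  using assms linear_diff[OF linear_P[of j], of x y] by (auto simp: tail_def)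

lemma br_layer_tail:
  assumes "x \<in> H a" "y \<in> H b" "a \<in> {1..\<iota>}" "b \<in> {1..\<iota>}" "j < a + b"
  shows "br x y \<in> tail (Suc j)"
proof (cases "a + b \<le> \<iota>")
  case True
  have "br x y \<in> H (a + b)" using br_layer assms by simp
  then show ?thesis
    using True assms P_of_layer[of "br x y" "a + b"] by (auto simp: tail_def)
next
  case False
  then have "br x y = 0" using br_layer[of a b x y] layer_trivial[of "a + b"] assms by auto
  then show ?thesis by (simp add: subspace_0[OF subspace_tail])
qed

text \<open>Brackets of layers add degrees, so the filtration is compatible with the bracket. Later
  one factor is known only to lie in \<open>tail 1\<close>, which contains everything; this still
  gains one degree.\<close>

lemma br_tail:
  assumes "x \<in> tail i" "y \<in> tail j" "k < i + j"
  shows "br x y \<in> tail (Suc k)"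
proof -
  have "br x y = br (\<Sum>a\<in>{1..\<iota>}. P a x) (\<Sum>b\<in>{1..\<iota>}. P b y)"
    using P_sum[of x] P_sum[of y] by simp
  also have "\<dots> = (\<Sum>(a, b)\<in>{1..\<iota>} \<times> {1..\<iota>}. br (P a x) (P b y))"
    by (rule bilinear_sum[OF bilinear_br])
  also have "\<dots> \<in> tail (Suc k)"
  proof (rule subspace_sum[OF subspace_tail], clarify)
    fix a b assume ab: "a \<in> {1..\<iota>}" "b \<in> {1..\<iota>}"
    show "br (P a x) (P b y) \<in> tail (Suc k)"
    proof (cases "a < i \<or> b < j")
      case True
      then have "P a x = 0 \<or> P b y = 0" using ab assms(1,2) by (auto simp: tail_def)
      then have "br (P a x) (P b y) = 0"
        using bilinear_lzero[OF bilinear_br] bilinear_rzero[OF bilinear_br] by auto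
      then show ?thesis by (simp add: subspace_0[OF subspace_tail])
    next
      case False
      with assms(3) ab show ?thesis by (intro br_layer_tail[of _ a _ b] P_layer) auto
    qed
  qed
  finally show ?thesis .
qed

text \<open>By bilinearity [a,N] - [b,N'] = [a-b,N] + [b,N-N']. In each summand an element of
  \<open>tail j\<close> is bracketed with another one, which has degree at least 1.\<close>

lemma nested_bracket_tail:
  assumes "list_all2 (\<lambda>a b. a - b \<in> tail j) u w" "2 \<le> length u"
  shows "nested_bracket br u - nested_bracket br w \<in> tail (Suc j)"
proof -
  \<comment> \<open>A single letter gains no degree, so the induction carries the weaker membership
    for all lengths alongside the stronger one.\<close>
  have "nested_bracket br u - nested_bracket br w \<in> tail j \<and>
    (2 \<le> length u \<longrightarrow> nested_bracket br u - nested_bracket br w \<in> tail (Suc j))"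
    using assms(1)
  proof (induction u w rule: list_all2_induct)
    case Nil
    then show ?case by (simp add: subspace_0[OF subspace_tail])
  next
    case (Cons a u b w)
    show ?case
    proof (cases u)
      case Nil
      with Cons show ?thesis by simp
    next
      case u: (Cons a' u')
      then obtain b' w' where w: "w = b' # w'" using Cons.hyps(2) by (cases w) auto
      let ?N = "nested_bracket br u" and ?N' = "nested_bracket br w"
      have eq: "nested_bracket br (a # u) - nested_bracket br (b # w) = br (a - b) ?N + br b (?N - ?N')"
        by (simp add: u w bilinear_lsub[OF bilinear_br] bilinear_rsub[OF bilinear_br])
      have "br (a - b) ?N \<in> tail (Suc j)"
        by (rule br_tail[OF Cons.hyps(1) tail_1]) simp
      moreover have "br b (?N - ?N') \<in> tail (Suc j)"
        by (rule br_tail[OF tail_1 conjunct1[OF Cons.IH]]) simp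
      ultimately have "nested_bracket br (a # u) - nested_bracket br (b # w) \<in> tail (Suc j)"
        unfolding eq by (rule subspace_add[OF subspace_tail])
      then show ?thesis using tail_Suc by blast
    qed
  qed
  with assms(2) show ?thesis by blast
qed

text \<open>The innermost bracket has two arguments equal up to sign and vanishes, which annihilates
  the outer ones.\<close>

lemma nested_bracket_collinear:
  assumes "\<And>a. a \<in> set u \<Longrightarrow> a \<in> {x, - x}" "2 \<le> length u"
  shows "nested_bracket br u = 0"
  using assms
proof (induction u rule: induct_list012)
  case (3 a b u)
  show ?case
  proof (cases u)
    case Nil
    have "a \<in> {x, - x}" "b \<in> {x, - x}" using 3(3) by auto
    then have "br a b = 0"
      by (auto simp: br_self bilinear_lneg[OF bilinear_br] bilinear_rneg[OF bilinear_br])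
    with Nil show ?thesis by simp
  next
    case (Cons c u')
    then have "nested_bracket br (b # u) = 0" using 3 by (intro 3(2)) auto
    then show ?thesis by (simp add: bilinear_rzero[OF bilinear_br])
  qed
qed auto

section \<open>The Baker-Campbell-Hausdorff product\<close>

definition dynkin_index :: "(nat \<times> nat) list set" where
  "dynkin_index = {ps. ps \<noteq> [] \<and> (\<forall>(r, s)\<in>set ps. 0 < r + s) \<and> dynkin_degree ps \<le> \<iota>}"

lemma length_dynkin_word: "length (dynkin_word x y ps) = dynkin_degree ps"
  by (induction ps) (auto simp: dynkin_word_def dynkin_degree_def)

lemma length_le_dynkin_degree:
  "\<forall>(r, s)\<in>set ps. 0 < r + s \<Longrightarrow> length ps \<le> dynkin_degree ps"
  by (induction ps) (auto simp: dynkin_degree_def)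

lemma le_dynkin_degree: "(r, s) \<in> set ps \<Longrightarrow> r + s \<le> dynkin_degree ps"
  by (induction ps) (auto simp: dynkin_degree_def)

lemma finite_dynkin_index: "finite dynkin_index"
proof (rule finite_subset)
  show "dynkin_index \<subseteq> {ps. set ps \<subseteq> {..\<iota>} \<times> {..\<iota>} \<and> length ps \<le> \<iota>}"
    using length_le_dynkin_degree le_dynkin_degree unfolding dynkin_index_def by fastforce
qed (simp add: finite_lists_length_le)

text \<open>These indices produce the linear part x + y of the product; all other terms contain a
  genuine bracket and are collected in \<open>bch_rest\<close>.\<close>

lemma dynkin_index_linear:
  "{ps \<in> dynkin_index. dynkin_degree ps < 2} = {[(1, 0)], [(0, 1)]}"
proof (intro set_eqI iffI)
  fix ps assume "ps \<in> {ps \<in> dynkin_index. dynkin_degree ps < 2}"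
  then have ps: "ps \<noteq> []" "\<forall>(r, s)\<in>set ps. 0 < r + s" "dynkin_degree ps < 2"
    by (auto simp: dynkin_index_def)
  have "length ps < 2" using length_le_dynkin_degree[OF ps(2)] ps(3) by linarith
  moreover have "length ps \<noteq> 0" using ps(1) by simp
  ultimately have "length ps = 1" by linarith
  then obtain r s where "ps = [(r, s)]" by (auto simp: length_Suc_conv)
  with ps show "ps \<in> {[(1, 0)], [(0, 1)]}" by (auto simp: dynkin_degree_def)
qed (use step_pos in \<open>auto simp: dynkin_index_def dynkin_degree_def\<close>)

definition bch_rest :: "'a \<Rightarrow> 'a \<Rightarrow> 'a" where
  "bch_rest x y = (\<Sum>ps | ps \<in> dynkin_index \<and> 2 \<le> dynkin_degree ps.
     dynkin_coeff ps *\<^sub>R nested_bracket br (dynkin_word x y ps))"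

lemma bch_split: "bch br \<iota> x y = x + y + bch_rest x y"
proof -
  let ?t = "\<lambda>ps. dynkin_coeff ps *\<^sub>R nested_bracket br (dynkin_word x y ps)"
  have "bch br \<iota> x y = sum ?t dynkin_index"
    by (simp add: bch_def dynkin_index_def)
  also have "\<dots> = sum ?t {ps \<in> dynkin_index. dynkin_degree ps < 2} + bch_rest x y"
  proof -
    let ?A = "{ps \<in> dynkin_index. dynkin_degree ps < 2}" and ?B = "{ps \<in> dynkin_index. 2 \<le> dynkin_degree ps}"
    have "sum ?t (?A \<union> ?B) = sum ?t ?A + sum ?t ?B"
      by (rule sum.union_disjoint) (auto simp: finite_dynkin_index)
    moreover have "?A \<union> ?B = dynkin_index" by auto
    ultimately show ?thesis by (simp add: bch_rest_def)
  qed
  also have "sum ?t {ps \<in> dynkin_index. dynkin_degree ps < 2} = x + y"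
    unfolding dynkin_index_linear by (simp add: dynkin_coeff_def dynkin_degree_def dynkin_word_def)
  finally show ?thesis .
qed

lemma set_dynkin_word: "set (dynkin_word x y ps) \<subseteq> {x, y}"
  unfolding dynkin_word_def by (induction ps) (simp_all add: split_def set_replicate_conv_if)

text \<open>The linear part cancels, and every further term is a nested bracket in letters z and -z,
  hence zero.\<close>

lemma bch_inverse: "bch br \<iota> (- z) z = 0"
proof -
  have "bch_rest (- z) z = 0"
    unfolding bch_rest_def
  proof (rule sum.neutral, clarify)
    fix ps assume "2 \<le> dynkin_degree ps"
    then have "nested_bracket br (dynkin_word (- z) z ps) = 0"
      using set_dynkin_word[of "- z" z ps]
      by (intro nested_bracket_collinear[of _ z]) (auto simp: length_dynkin_word)
    then show "dynkin_coeff ps *\<^sub>R nested_bracket br (dynkin_word (- z) z ps) = 0" by simp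
  qed
  then show ?thesis by (simp add: bch_split)
qed

text \<open>The source of triangularity: every term of the rest has at least two letters, so
  perturbing \<open>v\<close> in layers from \<open>j\<close> on affects the rest only beyond layer
  \<open>j\<close>.\<close>

lemma bch_rest_tail:
  assumes "v - v' \<in> tail j"
  shows "bch_rest z v - bch_rest z v' \<in> tail (Suc j)"
proof -
  have rel: "list_all2 (\<lambda>a b. a - b \<in> tail j) (dynkin_word z v ps) (dynkin_word z v' ps)" for ps
    unfolding dynkin_word_def
  proof (induction ps)
    case (Cons p ps)
    have "list_all2 (\<lambda>a b. a - b \<in> tail j) (replicate k x) (replicate k y)" if "x - y \<in> tail j" for k x y
      using that by (auto simp: list_all2_conv_all_nth)
    with Cons assms show ?case
      by (cases p) (auto intro!: list_all2_appendI simp: subspace_0[OF subspace_tail])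
  qed simp
  have "bch_rest z v - bch_rest z v' = (\<Sum>ps | ps \<in> dynkin_index \<and> 2 \<le> dynkin_degree ps.
     dynkin_coeff ps *\<^sub>R (nested_bracket br (dynkin_word z v ps) - nested_bracket br (dynkin_word z v' ps)))"
    by (simp add: bch_rest_def sum_subtractf scaleR_diff_right)
  also have "\<dots> \<in> tail (Suc j)"
    using nested_bracket_tail[OF rel]
    by (intro subspace_sum[OF subspace_tail] subspace_scale[OF subspace_tail]) (auto simp: length_dynkin_word)
  finally show ?thesis .
qed

lemma continuous_nested_bracket:
  assumes "list_all (\<lambda>f. continuous_on UNIV f) fs"
  shows "continuous_on UNIV (\<lambda>v. nested_bracket br (map (\<lambda>f. f v) fs))"
  using assms
proof (induction fs rule: induct_list012)
  case (3 f g fs)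
  have "bounded_bilinear br" using bilinear_br by (simp add: bilinear_conv_bounded_bilinear)
  from bounded_bilinear.continuous_on[OF this _ 3(2), of f] 3(3) show ?case by simp
qed auto

lemma continuous_bch_rest: "continuous_on UNIV (bch_rest z)"
proof -
  have "continuous_on UNIV (\<lambda>v. nested_bracket br (dynkin_word z v ps))" for ps
  proof -
    \<comment> \<open>The word is read as a list of functions of \<open>v\<close>, each constant or
      the identity, so that induction over its letters yields continuity.\<close>
    have eq: "dynkin_word z v ps = map (\<lambda>f. f v) (dynkin_word (\<lambda>_. z) (\<lambda>v. v) ps)" for v
      by (auto simp: dynkin_word_def map_concat comp_def case_prod_unfold)
    have "f = (\<lambda>_. z) \<or> f = (\<lambda>v. v)" if "f \<in> set (dynkin_word (\<lambda>_. z) (\<lambda>v. v) ps)" for f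
      using that set_dynkin_word[of "\<lambda>_. z" "\<lambda>v. v" ps] by auto
    then have "continuous_on UNIV f" if "f \<in> set (dynkin_word (\<lambda>_. z) (\<lambda>v. v) ps)" for f
      using that by (metis continuous_on_const continuous_on_id)
    then have "list_all (\<lambda>f. continuous_on UNIV f) (dynkin_word (\<lambda>_. z) (\<lambda>v. v) ps)"
      by (simp add: list_all_iff)
    then show ?thesis unfolding eq by (rule continuous_nested_bracket)
  qed
  then show ?thesis unfolding bch_rest_def by (intro continuous_intros)
qed

text \<open>For \<open>w\<close> orthogonal to \<open>V\<close>, the pairing of the dilates of
  \<open>v\<close> with \<open>w\<close> is a polynomial in r that vanishes for all r > 0. Its
  coefficients are the pairings of the \<open>P j v\<close> with \<open>w\<close>, so each
  \<open>P j v\<close> lies in the double orthogonal complement of \<open>V\<close>, which is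
  \<open>V\<close>.\<close>

lemma homogeneous_subspace_P:
  assumes V: "homogeneous_subspace H \<iota> V" and v: "v \<in> V" and j: "j \<in> {1..\<iota>}"
  shows "P j v \<in> V"
proof -
  have sub: "subspace V" and dil: "\<And>r. 0 < r \<Longrightarrow> dilation H \<iota> r v \<in> V"
    using V v by (auto simp: homogeneous_subspace_def)
  have "P j v \<bullet> w = 0" if w: "\<And>u. u \<in> V \<Longrightarrow> orthogonal u w" for w
  proof (rule ccontr)
    assume ne: "P j v \<bullet> w \<noteq> 0"
    \<comment> \<open>Layers start at 1, so the polynomial has zero constant coefficient.\<close>
    let ?c = "\<lambda>i. if i \<in> {1..\<iota>} then P i v \<bullet> w else 0"
    have "(\<Sum>i\<le>\<iota>. ?c i * r ^ i) = dilation H \<iota> r v \<bullet> w" for r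
    proof -
      have "(\<Sum>i\<le>\<iota>. ?c i * r ^ i) = (\<Sum>i\<in>{1..\<iota>}. (P i v \<bullet> w) * r ^ i)"
        by (intro sum.mono_neutral_cong_right) auto
      then show ?thesis by (simp add: dilation_def inner_sum_left mult.commute)
    qed
    then have "{0<..} \<subseteq> {r. (\<Sum>i\<le>\<iota>. ?c i * r ^ i) = 0}"
      using dil w by (auto simp: orthogonal_def)
    moreover have "finite {r. (\<Sum>i\<le>\<iota>. ?c i * r ^ i) = 0}"
      unfolding polyfun_finite_roots by (rule exI[of _ j]) (use ne j in auto)
    ultimately show False
      using infinite_Ioi[of "0::real"] finite_subset by blast
  qed
  then have "P j v \<in> orthogonal_comp (orthogonal_comp V)"
    by (auto simp: orthogonal_comp_def orthogonal_def inner_commute)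
  then show ?thesis using orthogonal_comp_self[OF sub] by simp
qed

text \<open>Monotonicity is given one variable at a time; \<open>mix\<close> replaces the
  coordinates of \<open>t\<close> by those of \<open>s\<close> successively without leaving the
  orthant.\<close>

lemma orthant_mono:
  assumes t: "t \<in> orthant \<iota>" and s: "s \<in> orthant \<iota>" and le: "\<And>i. i \<in> {1..\<iota>} \<Longrightarrow> t i \<le> s i"
    and mono: "\<forall>t\<in>orthant \<iota>. \<forall>i\<in>{1..\<iota>}. \<forall>s\<ge>t i. \<phi> t \<le> (\<phi> (t(i := s)) :: real)"
  shows "\<phi> t \<le> \<phi> s"
proof -
  define mix where "mix I i = (if i \<in> I then s i else t i)" for I i
  have mix_orthant: "mix I \<in> orthant \<iota>" if "I \<subseteq> {1..\<iota>}" for I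
    using t s that by (auto simp: orthant_def PiE_iff mix_def extensional_def)
  have "\<phi> t \<le> \<phi> (mix I)" if "finite I" "I \<subseteq> {1..\<iota>}" for I
    using that
  proof (induction I rule: finite_induct)
    case empty
    have "mix {} = t" by (auto simp: mix_def)
    then show ?case by simp
  next
    case (insert i I)
    have "\<phi> t \<le> \<phi> (mix I)" using insert by simp
    also have "\<dots> \<le> \<phi> ((mix I)(i := s i))"
      using insert le mix_orthant[of I] mono by (simp add: mix_def)
    also have "(mix I)(i := s i) = mix (insert i I)" by (auto simp: mix_def)
    finally show ?case .
  qed
  then have "\<phi> t \<le> \<phi> (mix {1..\<iota>})" by simp
  also have "mix {1..\<iota>} = s"
    using t s by (auto simp: fun_eq_iff mix_def orthant_def PiE_def extensional_def)
  finally show ?thesis .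
qed

section \<open>Balls of a multiradial distance\<close>

lemma continuous_P: "j \<in> {1..\<iota>} \<Longrightarrow> continuous_on S (P j)"
  by (rule linear_continuous_on) (simp add: linear_P linear_conv_bounded_linear[symmetric])

text \<open>One consequence for each property of the radial function: continuity makes the unit ball
  closed, monotonicity makes it solid with respect to the layer norms, and divergence at infinity
  bounds these norms.\<close>

lemma multiradial_unit_ball:
  assumes "multiradial br H \<iota> d"
  shows closed_unit_ball: "closed (dball d 0 1)"
    and unit_ball_solid: "\<And>x y. y \<in> dball d 0 1 \<Longrightarrow>
      (\<And>j. j \<in> {1..\<iota>} \<Longrightarrow> norm (P j x) \<le> norm (P j y)) \<Longrightarrow> x \<in> dball d 0 1"
    and unit_ball_bounded: "\<exists>K. \<forall>x\<in>dball d 0 1. \<forall>j\<in>{1..\<iota>}. norm (P j x) \<le> K"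
proof -
  obtain \<phi> :: "(nat \<Rightarrow> real) \<Rightarrow> real" where cont: "continuous_on (orthant \<iota>) \<phi>"
    and mono: "\<forall>t\<in>orthant \<iota>. \<forall>i\<in>{1..\<iota>}. \<forall>s\<ge>t i. \<phi> t \<le> \<phi> (t(i := s))"
    and lim: "filterlim \<phi> at_top
            (inf (filtercomap (\<lambda>t. L2_set t {1..\<iota>}) at_top) (principal (orthant \<iota>)))"
    and ball: "dball d 0 1 = {x. \<phi> (\<lambda>j\<in>{1..\<iota>}. norm (P j x)) \<le> 1}"
    using assms unfolding multiradial_def by blast
  define N where "N x = (\<lambda>j\<in>{1..\<iota>}. norm (P j x))" for x
  have N_orthant: "N x \<in> orthant \<iota>" for x
    by (auto simp: N_def orthant_def)
  have ball: "dball d 0 1 = {x. \<phi> (N x) \<le> 1}"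
    unfolding ball N_def ..
  have "continuous_on UNIV (\<lambda>x. N x j)" for j
    by (cases "j \<in> {1..\<iota>}") (auto simp: N_def intro!: continuous_on_norm continuous_P)
  then have "continuous_on UNIV N"
    by (rule continuous_on_coordinatewise_then_product)
  then have "continuous_on UNIV (\<lambda>x. \<phi> (N x))"
    by (rule continuous_on_compose2[OF cont]) (auto simp: N_orthant)
  then show "closed (dball d 0 1)"
    unfolding ball by (intro closed_Collect_le) auto
  show "x \<in> dball d 0 1" if "y \<in> dball d 0 1" "\<And>j. j \<in> {1..\<iota>} \<Longrightarrow> norm (P j x) \<le> norm (P j y)" for x y
  proof -
    have "\<phi> (N x) \<le> \<phi> (N y)"
      by (rule orthant_mono[OF N_orthant N_orthant _ mono]) (simp add: N_def that(2))
    with that(1) show ?thesis by (simp add: ball)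
  qed
  have "eventually (\<lambda>t. \<phi> t > 1) (inf (filtercomap (\<lambda>t. L2_set t {1..\<iota>}) at_top) (principal (orthant \<iota>)))"
    using lim by (simp add: filterlim_at_top_dense)
  then obtain K where K: "\<And>t. t \<in> orthant \<iota> \<Longrightarrow> K \<le> L2_set t {1..\<iota>} \<Longrightarrow> \<phi> t > 1"
    unfolding eventually_inf_principal eventually_filtercomap eventually_at_top_linorder by blast
  have "norm (P j x) \<le> K" if "x \<in> dball d 0 1" "j \<in> {1..\<iota>}" for x j
  proof -
    have "L2_set (N x) {1..\<iota>} < K"
      using K[OF N_orthant, of x] that(1) by (force simp: ball)
    moreover have "N x j \<le> L2_set (N x) {1..\<iota>}"
      using that(2) by (intro member_le_L2_set) auto
    ultimately show ?thesis using that(2) by (simp add: N_def)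
  qed
  then show "\<exists>K. \<forall>x\<in>dball d 0 1. \<forall>j\<in>{1..\<iota>}. norm (P j x) \<le> K" by blast
qed

lemma mem_dball:
  assumes "Metric_space UNIV d" shows "y \<in> dball d x r \<longleftrightarrow> d x y \<le> r"
  by (simp add: Metric_space.in_mcball[OF assms])

text \<open>Left invariance under \<open>- z\<close> moves the centre to (-z)z, which is the unit
  0.\<close>

lemma dball_translate:
  assumes "homogeneous_distance br H \<iota> d"
  shows "y \<in> dball d z r \<longleftrightarrow> bch br \<iota> (- z) y \<in> dball d 0 r"
proof -
  have "d z y = d (bch br \<iota> (- z) z) (bch br \<iota> (- z) y)"
    using assms by (simp add: homogeneous_distance_def)
  with assms show ?thesis
    by (simp add: bch_inverse mem_dball homogeneous_distance_def)
qed

lemma continuous_bch: "continuous_on UNIV (bch br \<iota> z)"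
  unfolding bch_split by (intro continuous_intros continuous_bch_rest)

lemma closed_dball:
  assumes "multiradial br H \<iota> d" shows "closed (dball d z 1)"
proof -
  have "dball d z 1 = bch br \<iota> (- z) -` dball d 0 1"
    using assms dball_translate by (auto simp: multiradial_def)
  then show ?thesis
    using continuous_bch closed_unit_ball[OF assms] by (simp add: continuous_on_closed_vimage)
qed

text \<open>Points of the ball have distance at most 2 from 0, and dilation by 1/2 brings them into
  the unit ball. Undoing it multiplies the bound for layer \<open>j\<close> by 2^j.\<close>

lemma bounded_dball:
  assumes mr: "multiradial br H \<iota> d" and z: "z \<in> dball d 0 1" shows "bounded (dball d z 1)"
proof -
  have hd: "homogeneous_distance br H \<iota> d" and ms: "Metric_space UNIV d"
    using mr by (auto simp: multiradial_def homogeneous_distance_def)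
  obtain K where K: "\<And>x j. x \<in> dball d 0 1 \<Longrightarrow> j \<in> {1..\<iota>} \<Longrightarrow> norm (P j x) \<le> K"
    using unit_ball_bounded[OF mr] by blast
  have "norm y \<le> (\<Sum>j\<in>{1..\<iota>}. 2 ^ j * K)" if y: "y \<in> dball d z 1" for y
  proof -
    have "d 0 y \<le> d 0 z + d z y" by (rule Metric_space.triangle[OF ms]) auto
    then have "d 0 y \<le> 2" using y z by (simp add: mem_dball[OF ms])
    moreover have "d (dilation H \<iota> (1/2) 0) (dilation H \<iota> (1/2) y) = 1/2 * d 0 y"
      using hd unfolding homogeneous_distance_def by (metis half_gt_zero_iff zero_less_one)
    ultimately have *: "dilation H \<iota> (1/2) y \<in> dball d 0 1"
      by (simp add: mem_dball[OF ms])
    have "norm (P j y) \<le> 2 ^ j * K" if "j \<in> {1..\<iota>}" for j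
      using K[OF * that] that by (simp add: P_dilation power_one_over field_simps)
    then have "(\<Sum>j\<in>{1..\<iota>}. norm (P j y)) \<le> (\<Sum>j\<in>{1..\<iota>}. 2 ^ j * K)" by (rule sum_mono)
    with norm_le_sum_P[of y] show ?thesis by (rule order_trans)
  qed
  then show ?thesis unfolding bounded_iff by blast
qed

section \<open>Orthonormal frames adapted to the layers\<close>

lemma inner_layer:
  assumes orth: "orthogonal_layers H \<iota>" and w: "w \<in> H j" and j: "j \<in> {1..\<iota>}"
  shows "u \<bullet> w = P j u \<bullet> w"
proof -
  have "P i u \<bullet> w = 0" if "i \<in> {1..\<iota>}" "i \<noteq> j" for i
    using orth P_layer[OF that(1), of u] w j that by (auto simp: orthogonal_layers_def orthogonal_def)
  then have "(\<Sum>i\<in>{1..\<iota>}. P i u \<bullet> w) = (\<Sum>i\<in>{j}. P i u \<bullet> w)"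
    using j by (intro sum.mono_neutral_right) auto
  then show ?thesis
    by (subst P_sum[of u]) (simp add: inner_sum_left)
qed

text \<open>Since \<open>V\<close> contains the layer components of its vectors, it is the
  orthogonal sum of its intersections with the layers, and orthonormal bases of these can be
  united.\<close>

lemma adapted_frame:
  assumes orth: "orthogonal_layers H \<iota>" and V: "homogeneous_subspace H \<iota> V" and n: "dim V = n"
  obtains e :: "nat \<Rightarrow> 'a" and l :: "nat \<Rightarrow> nat" where
    "orthonormal_frame e n" "span (e ` {..<n}) = V"
    "\<And>i. i < n \<Longrightarrow> l i \<in> {1..\<iota>} \<and> e i \<in> H (l i)"
    "\<And>i j. i \<le> j \<Longrightarrow> j < n \<Longrightarrow> l i \<le> l j"
proof -
  have sub: "subspace V" using V by (simp add: homogeneous_subspace_def)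
  let ?basis = "\<lambda>j B. B \<subseteq> V \<inter> H j \<and> pairwise orthogonal B \<and> (\<forall>x\<in>B. norm x = 1) \<and>
    independent B \<and> span B = V \<inter> H j"
  define B where "B j = (SOME B. ?basis j B)" for j
  have basis: "?basis j (B j)" if "j \<in> {1..\<iota>}" for j
    unfolding B_def
  proof (rule someI_ex)
    show "\<exists>B. ?basis j B"
      using orthonormal_basis_subspace[OF subspace_inter[OF sub layer_subspace[of j]]] that
      by (metis atLeastAtMost_iff)
  qed
  have B: "B j \<subseteq> V \<inter> H j" "pairwise orthogonal (B j)" "\<And>x. x \<in> B j \<Longrightarrow> norm x = 1"
    "independent (B j)" "span (B j) = V \<inter> H j" if "j \<in> {1..\<iota>}" for j
    using basis[OF that] by blast+
  define A where "A = (\<Union>j\<in>{1..\<iota>}. B j)"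
  have A_orth: "pairwise orthogonal A"
  proof (rule pairwiseI)
    fix x y assume "x \<in> A" "y \<in> A" "x \<noteq> y"
    then obtain i j where ij: "i \<in> {1..\<iota>}" "j \<in> {1..\<iota>}" "x \<in> B i" "y \<in> B j" by (auto simp: A_def)
    show "orthogonal x y"
    proof (cases "i = j")
      case True
      then show ?thesis using B(2)[of i] ij \<open>x \<noteq> y\<close> by (auto simp: pairwise_def)
    next
      case False
      moreover have "x \<in> H i" "y \<in> H j" using B(1) ij by blast+
      ultimately show ?thesis using ij orth unfolding orthogonal_layers_def by blast
    qed
  qed
  have A_norm: "norm x = 1" if "x \<in> A" for x using that B(3) by (auto simp: A_def)
  have A_indep: "independent A"
    using A_orth A_norm[of 0] by (intro pairwise_orthogonal_independent) auto
  have A_span: "span A = V"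
  proof
    show "span A \<subseteq> V" by (rule span_minimal[OF _ sub]) (use B(1) in \<open>unfold A_def, blast\<close>)
    show "V \<subseteq> span A"
    proof
      fix v assume v: "v \<in> V"
      have "P j v \<in> span A" if j: "j \<in> {1..\<iota>}" for j
      proof -
        have "P j v \<in> span (B j)"
          using B(5)[OF j] homogeneous_subspace_P[OF V v j] P_layer[OF j] by simp
        moreover have "span (B j) \<subseteq> span A" by (rule span_mono) (use j in \<open>auto simp: A_def\<close>)
        ultimately show ?thesis by blast
      qed
      then show "v \<in> span A" by (subst P_sum[of v]) (rule span_sum)
    qed
  qed
  define lay where "lay x = (SOME j. j \<in> {1..\<iota>} \<and> x \<in> B j)" for x
  have lay: "lay x \<in> {1..\<iota>} \<and> x \<in> B (lay x)" if "x \<in> A" for x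
    unfolding lay_def by (rule someI_ex) (use that in \<open>auto simp: A_def\<close>)
  have "finite A" using A_indep by (rule independent_imp_finite)
  then obtain xs0 where xs0: "set xs0 = A" "distinct xs0" using finite_distinct_list by blast
  \<comment> \<open>Sorting by layer turns the filtration into the order of the coordinates, as a
    triangular shear requires.\<close>
  define xs where "xs = sort_key lay xs0"
  have xs: "set xs = A" "distinct xs" "sorted (map lay xs)"
    using xs0 by (auto simp: xs_def)
  have len: "length xs = n"
  proof -
    have "length xs = card A" using distinct_card[OF xs(2)] xs(1) by simp
    also have "\<dots> = dim V" using dim_span_eq_card_independent[OF A_indep] A_span by simp
    finally show ?thesis using n by simp
  qed
  have mem: "xs ! i \<in> A" if "i < n" for i using that len xs(1) nth_mem by blast
  show ?thesis
  proof (rule that[of "\<lambda>i. xs ! i" "\<lambda>i. lay (xs ! i)"])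
    show "orthonormal_frame ((!) xs) n"
    proof
      fix i j assume ij: "i < n" "j < n"
      show "xs ! i \<bullet> xs ! j = (if i = j then 1 else 0)"
      proof (cases "i = j")
        case True
        then show ?thesis using A_norm[OF mem[OF ij(1)]] by (simp add: norm_eq_1)
      next
        case False
        then have "xs ! i \<noteq> xs ! j" using xs(2) ij len by (simp add: nth_eq_iff_index_eq)
        then show ?thesis
          using A_orth mem ij False by (auto simp: pairwise_def orthogonal_def)
      qed
    qed
    have "(!) xs ` {..<n} = A" using xs(1) len by (auto simp: set_conv_nth)
    then show "span ((!) xs ` {..<n}) = V" using A_span by simp
    show "lay (xs ! i) \<in> {1..\<iota>} \<and> xs ! i \<in> H (lay (xs ! i))" if "i < n" for i
      using lay[OF mem[OF that]] B(1) by blast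
    show "lay (xs ! i) \<le> lay (xs ! j)" if "i \<le> j" "j < n" for i j
      using sorted_nth_mono[OF xs(3) that(1)] that len by simp
  qed
qed

lemma hausdorff_translated_ball_le:
  assumes orth: "orthogonal_layers H \<iota>" and mr: "multiradial br H \<iota> d"
    and V: "homogeneous_subspace H \<iota> V" and z: "z \<in> dball d 0 1"
  shows "hausdorff_measure (dim V) (V \<inter> dball d z 1) \<le> hausdorff_measure (dim V) (V \<inter> dball d 0 1)"
proof -
  define n where "n = dim V"
  have hd: "homogeneous_distance br H \<iota> d" and ms: "Metric_space UNIV d"
    using mr by (auto simp: multiradial_def homogeneous_distance_def)
  obtain e l where frame: "orthonormal_frame e n" and span: "span (e ` {..<n}) = V"
    and el: "\<And>i. i < n \<Longrightarrow> l i \<in> {1..\<iota>} \<and> e i \<in> H (l i)"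
    and mono: "\<And>i j. i \<le> j \<Longrightarrow> j < n \<Longrightarrow> l i \<le> l j"
    using adapted_frame[OF orth V n_def[symmetric]] by blast
  interpret orthonormal_frame e n by (rule frame)
  have plane: "plane = V" using plane_eq_span span by simp
  have sub: "subspace V" using V by (simp add: homogeneous_subspace_def)
  define G where "G v = bch br \<iota> (- z) v - v" for v
  \<comment> \<open>The displacement caused by the translation, read off along \<open>e k\<close> at
    the point that keeps only the coordinates below \<open>k\<close>.\<close>
  define g where "g k x = G (\<Sum>i<k. x i *\<^sub>R e i) \<bullet> e k" for k and x :: "nat \<Rightarrow> real"
  have G_tail: "G v - G v' \<in> tail (Suc j)" if "v - v' \<in> tail j" for v v' j
    using bch_rest_tail[OF that, of "- z"] by (simp add: G_def bch_split)
  have "continuous_on UNIV G"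
    unfolding G_def by (intro continuous_intros continuous_bch)
  then have G_borel: "G \<in> borel_measurable borel"
    by (rule borel_measurable_continuous_onI)
  have g_measurable: "g k \<in> borel_measurable (coord_measure k)" for k
  proof -
    have "(\<lambda>x. \<Sum>i<k. x i *\<^sub>R e i) \<in> borel_measurable (coord_measure k)" by measurable
    from measurable_compose[OF this G_borel]
    have [measurable]: "(\<lambda>x. G (\<Sum>i<k. x i *\<^sub>R e i)) \<in> borel_measurable (coord_measure k)" .
    show ?thesis unfolding g_def by measurable
  qed
  \<comment> \<open>The discarded coordinates \<open>i \<ge> k\<close> belong to layers at least
    \<open>l k\<close>, so they change the displacement only beyond layer \<open>l k\<close>, which
    \<open>e k\<close> does not see. This covers other frame vectors in the layer of
    \<open>e k\<close> as well.\<close>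
  have shear: "triangular_shear n g x k = bch br \<iota> (- z) (emb x) \<bullet> e k" if k: "k < n" for x k
  proof -
    let ?v' = "\<Sum>i<k. x i *\<^sub>R e i"
    have "emb x - ?v' = (\<Sum>i\<in>{k..<n}. x i *\<^sub>R e i)"
    proof -
      have "emb x = ?v' + (\<Sum>i\<in>{k..<n}. x i *\<^sub>R e i)"
        unfolding emb_def lessThan_atLeast0 using k by (intro sum.atLeastLessThan_concat[symmetric]) auto
      then show ?thesis by simp
    qed
    also have "\<dots> \<in> tail (l k)"
    proof (intro subspace_sum[OF subspace_tail] subspace_scale[OF subspace_tail])
      fix i assume "i \<in> {k..<n}"
      then show "e i \<in> tail (l k)"
        using mono[of k i] el[of i] by (auto simp: tail_def P_of_layer)
    qed
    finally have "G (emb x) - G ?v' \<in> tail (Suc (l k))"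
      by (rule G_tail)
    then have "P (l k) (G (emb x)) = P (l k) (G ?v')"
      using el[OF k] by (intro P_eq_of_tail) auto
    then have "G (emb x) \<bullet> e k = G ?v' \<bullet> e k"
      using el[OF k] inner_layer[OF orth] by metis
    then have "triangular_shear n g x k = emb x \<bullet> e k + G (emb x) \<bullet> e k"
      using k by (simp add: triangular_shear_def g_def inner_emb)
    then show ?thesis by (simp add: G_def inner_diff_left)
  qed
  have shear_ball: "emb (triangular_shear n g x) \<in> dball d 0 1" if "emb x \<in> dball d z 1" for x
  proof -
    define u where "u = bch br \<iota> (- z) (emb x)"
    define p where "p = emb (triangular_shear n g x)"
    have "u \<in> dball d 0 1" using that dball_translate[OF hd] by (simp add: u_def)
    moreover have "norm (P j p) \<le> norm (P j u)" if j: "j \<in> {1..\<iota>}" for j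
    proof -
      let ?w = "P j p"
      have "p \<in> V"
        unfolding p_def plane[symmetric] plane_def by (simp add: space_M triangular_shear_def)
      then have "?w \<in> V" by (rule homogeneous_subspace_P[OF V _ j])
      then obtain c where c: "?w = emb c" unfolding plane[symmetric] plane_def by blast
      \<comment> \<open>By \<open>shear\<close>, \<open>p\<close> is the orthogonal projection of
        \<open>u\<close> to \<open>V\<close>, and \<open>?w\<close> is in \<open>V\<close> by
        homogeneity. As \<open>?w\<close> also lies in layer \<open>j\<close>, this gives |w|^2 =
        <p,w> = <u,w> = <P j u,w>, and Cauchy-Schwarz finishes.\<close>
      have "p \<bullet> ?w = u \<bullet> ?w"
        unfolding c emb_def[of c] inner_sum_right inner_scaleR_right
        by (rule sum.cong) (simp_all add: p_def inner_emb shear u_def)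
      then have "?w \<bullet> ?w = P j u \<bullet> ?w"
        using inner_layer[OF orth P_layer[OF j] j] by metis
      then have "norm ?w * norm ?w \<le> norm (P j u) * norm ?w"
        using norm_cauchy_schwarz[of "P j u" ?w] by (simp add: dot_square_norm power2_eq_square)
      then show ?thesis
        by (cases "norm ?w = 0") (auto simp: mult_le_cancel_right)
    qed
    ultimately show ?thesis
      unfolding p_def[symmetric] by (rule unit_ball_solid[OF mr])
  qed
  have borel: "dball d z' 1 \<in> sets borel" for z'
    using closed_dball[OF mr] by (rule borel_closed)
  have "pushed (dball d z 1) \<le> emeasure M (triangular_shear n g -` (emb -` dball d 0 1 \<inter> space M) \<inter> space M)"
    unfolding pushed_def
  proof (rule emeasure_mono)
    show "emb -` dball d z 1 \<inter> space M \<subseteq> triangular_shear n g -` (emb -` dball d 0 1 \<inter> space M) \<inter> space M"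
      using shear_ball by (auto simp: space_M triangular_shear_def)
    show "triangular_shear n g -` (emb -` dball d 0 1 \<inter> space M) \<inter> space M \<in> sets M"
      by (rule measurable_sets[OF measurable_triangular_shear[OF g_measurable] sets_vimage_emb[OF borel]])
  qed
  also have "\<dots> = pushed (dball d 0 1)"
    unfolding pushed_def by (rule emeasure_triangular_shear[OF g_measurable sets_vimage_emb[OF borel]])
  finally have pushed_le: "pushed (dball d z 1) \<le> pushed (dball d 0 1)" .
  have "0 \<in> dball d 0 1" by (simp add: mem_dball[OF ms] Metric_space.mdist_zero[OF ms])
  \<comment> \<open>The same constant appears for both centres, so the comparison of Lebesgue
    measures transfers to Hausdorff measures.\<close>
  have eq: "hausdorff_measure n (dball d z' 1 \<inter> plane) = density_const * pushed (dball d z' 1)"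
    if "z' \<in> dball d 0 1" for z'
    using bounded_dball[OF mr that] by (intro hausdorff_borel_eq borel) (auto intro: bounded_subset)
  show ?thesis
    using eq[OF z] eq[OF \<open>0 \<in> dball d 0 1\<close>] pushed_le
    unfolding n_def[symmetric] plane Int_commute[of V] by (simp add: mult_left_mono)
qed

end

theorem theorem3p1:
  fixes br :: "'a::euclidean_space \<Rightarrow> 'a \<Rightarrow> 'a"
    and H :: "nat \<Rightarrow> 'a set"
    and \<iota> n :: nat
    and d :: "'a \<Rightarrow> 'a \<Rightarrow> real"
    and V :: "'a set"
  assumes "graded_group br H \<iota>"
    and "orthogonal_layers H \<iota>"
    and "multiradial br H \<iota> d"
    and "1 \<le> n" and "n \<le> DIM('a) - 1"
    and "homogeneous_subspace H \<iota> V"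
    and "dim V = n"
  shows "spherical_factor d V = hausdorff_measure n (V \<inter> dball d 0 1)"
proof -
  interpret graded_group br H \<iota> by fact
  have ms: "Metric_space UNIV d"
    using assms(3) by (simp add: multiradial_def homogeneous_distance_def)
  have "0 \<in> dball d 0 1"
    by (simp add: mem_dball[OF ms] Metric_space.mdist_zero[OF ms])
  then show ?thesis
    unfolding spherical_factor_def assms(7)[symmetric]
    by (intro antisym SUP_least SUP_upper hausdorff_translated_ball_le assms)
qed

end
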